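(* Let $\texttt{DT}$ denote the set of decision trees computing boolean functions. The problem $\texttt{SHAP}(\texttt{DT},\overrightarrow{\texttt{MARKOV}})$ is in FP. That is, there is an algorithm which, given a decision tree $T$ over $N$ boolean variables, an instance $x\in\{0,1\}^N$, an integer $i\in[N]$ and a Markovian distribution $P\in\overrightarrow{\texttt{MARKOV}}_N$ on $\{0,1\}^N$, computes exactly $\overrightarrow{\mathrm{SHAP}}(T,x,i,P)$ in time polynomial in the size of the instance (the size of $T$ and $N$).
   Context: $[N]=\{1,\dots,N\}$. A decision tree over boolean variables $X_1,\dots,X_N$ is a rooted binary tree whose internal nodes are labeled by variables, with the two outgoing edges labeled $0$ and $1$, and whose leaves are labeled by $0$ or $1$; it computes the boolean function $f_T:\{0,1\}^N\to\{0,1\}$ giving the label of the leaf reached by following the values of the tested variables. Its size is its number of nodes. $\overrightarrow{\texttt{MARKOV}}_N$: the set of distributions on $\{0,1\}^N$ of the form $P(X_1,\dots,X_N)=P_{init}(X_1)\prod_{j=1}^{N-1}P_j(X_{j+1}\mid X_j)$, where $P_{init}$ is a probability distribution on $\{0,1\}$ and each $P_j$ is a $2\times2$ stochastic matrix; all entries of $P_{init}$ and of the $P_j$ are assumed $>0$. $P$ is given by these parameters. SHAP score: for a model $M$ computing $f_M:\{0,1\}^N\to\mathbb{R}$, $$\overrightarrow{\mathrm{SHAP}}(M,x,i,P)=\sum_{S\subsetneq[N]}\frac{|S|!\,(N-|S|-1)!}{N!}\big[v(S;M,x,P)-v(S\setminus\{i\};M,x,P)\big],$$ with $v(S;M,x,P)=\mathbb{E}_{X\sim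 P}[f_M(X)\mid X_S=x_S]$, where $X_S=x_S$ means $X_j=x_j$ for all $j\in S$. FP: a function problem is in FP if it can be computed exactly by an algorithm running in time polynomial in the size of the instance. Running time counts elementary operations, including arithmetic operations on real numbers. *)

theory Defs
  imports
    "HOL-Probability.Probability"
    "HOL-Computational_Algebra.Polynomial"
begin

section \<open>Decision trees\<close>

text \<open>\<open>Node v T0 T1\<close> tests the variable \<open>X\<^sub>v\<close>; \<open>T0\<close> hangs below the edge labelled 0 and
  \<open>T1\<close> below the edge labelled 1. A variable may be tested repeatedly along a path.\<close>

datatype dtree = Leaf bool | Node nat dtree dtree

primrec dt_eval :: "dtree \<Rightarrow> (nat \<Rightarrow> bool) \<Rightarrow> bool" where
  "dt_eval (Leaf b) z = b"
| "dt_eval (Node v T0 T1) z = (if z v then dt_eval T1 z else dt_eval T0 z)"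

primrec dt_vars :: "dtree \<Rightarrow> nat set" where
  "dt_vars (Leaf b) = {}"
| "dt_vars (Node v T0 T1) = insert v (dt_vars T0 \<union> dt_vars T1)"

primrec dt_size :: "dtree \<Rightarrow> nat" where
  "dt_size (Leaf b) = 1"
| "dt_size (Node v T0 T1) = 1 + dt_size T0 + dt_size T1"

definition DT :: "nat \<Rightarrow> dtree set" where
  "DT N = {T. dt_vars T \<subseteq> {1..N}}"

definition dt_fun :: "dtree \<Rightarrow> (nat \<Rightarrow> bool) \<Rightarrow> real" where
  "dt_fun T z = of_bool (dt_eval T z)"


section \<open>Markovian distributions\<close>

text \<open>\<open>{0,1}\<^sup>N\<close>, with coordinates numbered \<open>1, \<dots>, N\<close> (and value \<open>undefined\<close> elsewhere, so that
  this is a finite set with \<open>2\<^sup>N\<close> elements).\<close>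

definition cube :: "nat \<Rightarrow> (nat \<Rightarrow> bool) set" where
  "cube N = {1..N} \<rightarrow>\<^sub>E UNIV"

text \<open>The parameters: \<open>P\<^sub>i\<^sub>n\<^sub>i\<^sub>t(a)\<close> is \<open>pmf p a\<close>, and the entry \<open>P\<^sub>j(b | a)\<close> of the \<open>j\<close>-th stochastic
  matrix is \<open>pmf (K j a) b\<close>; being a \<open>bool pmf\<close>, each row is nonnegative with sum 1.\<close>

definition markov_weight ::
    "nat \<Rightarrow> bool pmf \<Rightarrow> (nat \<Rightarrow> bool \<Rightarrow> bool pmf) \<Rightarrow> (nat \<Rightarrow> bool) \<Rightarrow> real" where
  "markov_weight N p K z = pmf p (z 1) * (\<Prod>j = 1..N-1. pmf (K j (z j)) (z (j + 1)))"

definition markov :: "nat \<Rightarrow> bool pmf \<Rightarrow> (nat \<Rightarrow> bool \<Rightarrow> bool pmf) \<Rightarrow> (nat \<Rightarrow> bool) pmf" where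
  "markov N p K = embed_pmf (\<lambda>z. if z \<in> cube N then markov_weight N p K z else 0)"

definition positive_params :: "nat \<Rightarrow> bool pmf \<Rightarrow> (nat \<Rightarrow> bool \<Rightarrow> bool pmf) \<Rightarrow> bool" where
  "positive_params N p K \<longleftrightarrow>
     (\<forall>a. pmf p a > 0) \<and> (\<forall>j \<in> {1..N-1}. \<forall>a b. pmf (K j a) b > 0)"

text \<open>\<open>embed_pmf\<close> is only meaningful for weights that sum to 1; the following lemmas establish this.\<close>

lemma finite_cube: "finite (cube N)"
  unfolding cube_def by (intro finite_PiE) auto

lemma sum_pmf_bool: "(\<Sum>b\<in>UNIV. pmf (q :: bool pmf) b) = 1"
  by (rule sum_pmf_eq_1) auto

lemma sum_cube_Suc: "(\<Sum>z\<in>cube (Suc N). f z) = (\<Sum>z\<in>cube N. \<Sum>b\<in>UNIV. f (z(Suc N := b)))"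
  for f :: "(nat \<Rightarrow> bool) \<Rightarrow> real"
proof -
  have eq: "cube (Suc N) = (\<lambda>(b, z). z(Suc N := b)) ` (UNIV \<times> cube N)"
    unfolding cube_def by (simp add: atLeastAtMostSuc_conv PiE_insert_eq)
  have inj: "inj_on (\<lambda>(b, z). z(Suc N := b)) (UNIV \<times> cube N)"
    unfolding cube_def by (rule inj_combinator) auto
  show ?thesis
    unfolding eq sum.reindex[OF inj]
    by (subst sum.swap) (simp add: sum.cartesian_product case_prod_unfold)
qed

lemma markov_weight_Suc:
  assumes "N \<ge> 1"
  shows "markov_weight (Suc N) p K (z(Suc N := b)) = markov_weight N p K z * pmf (K N (z N)) b"
proof -
  obtain M where M: "N = Suc M" using assms by (cases N) auto
  have "(\<Prod>j = 1..M. pmf (K j ((z(Suc N := b)) j)) ((z(Suc N := b)) (j + 1)))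
      = (\<Prod>j = 1..M. pmf (K j (z j)) (z (j + 1)))"
    by (rule prod.cong) (auto simp: M)
  then show ?thesis
    by (simp add: markov_weight_def M prod.atLeast_Suc_atMost_Suc_shift del: fun_upd_apply)
       (simp add: M)
qed

lemma sum_markov_weight:
  assumes "N \<ge> 1"
  shows "(\<Sum>z\<in>cube N. markov_weight N p K z) = 1"
  using assms
proof (induction N rule: nat_induct_at_least)
  case base
  have "cube 0 = {\<lambda>_. undefined}" by (simp add: cube_def)
  then show ?case
    using sum_cube_Suc[of "markov_weight 1 p K" 0] by (simp add: markov_weight_def sum_pmf_bool)
next
  case (Suc N)
  then show ?case
    by (simp add: sum_cube_Suc markov_weight_Suc sum_pmf_bool flip: sum_distrib_left)
qed

lemma pmf_markov:
  assumes "N \<ge> 1"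
  shows "pmf (markov N p K) z = (if z \<in> cube N then markov_weight N p K z else 0)"
  unfolding markov_def
proof (rule pmf_embed_pmf)
  show nonneg: "0 \<le> (if z \<in> cube N then markov_weight N p K z else 0)" for z
    by (simp add: markov_weight_def prod_nonneg)
  have "(\<integral>\<^sup>+z. ennreal (if z \<in> cube N then markov_weight N p K z else 0) \<partial>count_space UNIV)
      = (\<Sum>z\<in>cube N. ennreal (if z \<in> cube N then markov_weight N p K z else 0))"
    by (rule nn_integral_count_space') (auto simp: finite_cube)
  also have "\<dots> = ennreal (\<Sum>z\<in>cube N. if z \<in> cube N then markov_weight N p K z else 0)"
    by (rule sum_ennreal) (rule nonneg)
  also have "\<dots> = 1"
    using sum_markov_weight[OF assms] by simp
  finally show "(\<integral>\<^sup>+z. ennreal (if z \<in> cube N then markov_weight N p K z else 0)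
      \<partial>count_space UNIV) = 1" .
qed


section \<open>SHAP scores\<close>

definition shap_value ::
    "((nat \<Rightarrow> bool) \<Rightarrow> real) \<Rightarrow> (nat \<Rightarrow> bool) \<Rightarrow> (nat \<Rightarrow> bool) pmf \<Rightarrow> nat set \<Rightarrow> real" where
  "shap_value f x P S = measure_pmf.expectation (cond_pmf P {z. \<forall>j\<in>S. z j = x j}) f"

text \<open>The sum ranges over all proper subsets and the difference is \<open>v(S) - v(S - {i})\<close>,
  so only the sets containing \<open>i\<close> contribute.\<close>

definition shap ::
    "nat \<Rightarrow> ((nat \<Rightarrow> bool) \<Rightarrow> real) \<Rightarrow> (nat \<Rightarrow> bool) \<Rightarrow> nat \<Rightarrow> (nat \<Rightarrow> bool) pmf \<Rightarrow> real" where
  "shap N f x i P =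
     (\<Sum>S | S \<subset> {1..N}.
        fact (card S) * fact (N - card S - 1) / fact N
          * (shap_value f x P S - shap_value f x P (S - {i})))"


section \<open>Random access machines over the reals\<close>

text \<open>A program is a while program over finitely many arrays of natural numbers (indices, counters,
  discrete data) and finitely many arrays of reals, each with random access; a scalar variable is the
  cell 0 of an array. All operations have unit cost and are charged individually.

  Natural numbers can be added, subtracted (with cut-off at 0) and compared, but not multiplied or
  divided. So the largest natural number in the store at most grows by a constant factor (depending
  on the program) per executed command, and in polynomial time only numbers of polynomial bit length
  arise. Reals admit the field operations and comparisons, but no rounding; the only real constants
  are 0 and 1, and reals influence natural numbers only through the outcome of comparisons.
  The convention \<open>r / 0 = 0\<close> adds no power, as it can be programmed with a comparison.\<close>

datatype nexp =
    NConst nat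
  | NCell nat nexp          \<comment> \<open>array name, index\<close>
  | NAdd nexp nexp
  | NSub nexp nexp

datatype rexp =
    RZero
  | ROne
  | RCell nat nexp
  | RAdd rexp rexp
  | RSub rexp rexp
  | RMul rexp rexp
  | RDiv rexp rexp

datatype bexp =
    NLess nexp nexp
  | RLess rexp rexp
  | BNot bexp
  | BAnd bexp bexp

datatype com =
    SKIP
  | NAssign nat nexp nexp   \<comment> \<open>array name, index, value\<close>
  | RAssign nat nexp rexp
  | Seq com com
  | Cond bexp com com
  | While bexp com

type_synonym store = "(nat \<Rightarrow> nat \<Rightarrow> nat) \<times> (nat \<Rightarrow> nat \<Rightarrow> real)"

primrec nval :: "nexp \<Rightarrow> store \<Rightarrow> nat" where
  "nval (NConst n) s = n"
| "nval (NCell a e) s = fst s a (nval e s)"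
| "nval (NAdd e1 e2) s = nval e1 s + nval e2 s"
| "nval (NSub e1 e2) s = nval e1 s - nval e2 s"

primrec rval :: "rexp \<Rightarrow> store \<Rightarrow> real" where
  "rval RZero s = 0"
| "rval ROne s = 1"
| "rval (RCell a e) s = snd s a (nval e s)"
| "rval (RAdd r1 r2) s = rval r1 s + rval r2 s"
| "rval (RSub r1 r2) s = rval r1 s - rval r2 s"
| "rval (RMul r1 r2) s = rval r1 s * rval r2 s"
| "rval (RDiv r1 r2) s = rval r1 s / rval r2 s"

primrec bval :: "bexp \<Rightarrow> store \<Rightarrow> bool" where
  "bval (NLess e1 e2) s \<longleftrightarrow> nval e1 s < nval e2 s"
| "bval (RLess r1 r2) s \<longleftrightarrow> rval r1 s < rval r2 s"
| "bval (BNot b) s \<longleftrightarrow> \<not> bval b s"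
| "bval (BAnd b1 b2) s \<longleftrightarrow> bval b1 s \<and> bval b2 s"

primrec ncost :: "nexp \<Rightarrow> nat" where
  "ncost (NConst n) = 1"
| "ncost (NCell a e) = 1 + ncost e"
| "ncost (NAdd e1 e2) = 1 + ncost e1 + ncost e2"
| "ncost (NSub e1 e2) = 1 + ncost e1 + ncost e2"

primrec rcost :: "rexp \<Rightarrow> nat" where
  "rcost RZero = 1"
| "rcost ROne = 1"
| "rcost (RCell a e) = 1 + ncost e"
| "rcost (RAdd r1 r2) = 1 + rcost r1 + rcost r2"
| "rcost (RSub r1 r2) = 1 + rcost r1 + rcost r2"
| "rcost (RMul r1 r2) = 1 + rcost r1 + rcost r2"
| "rcost (RDiv r1 r2) = 1 + rcost r1 + rcost r2"

primrec bcost :: "bexp \<Rightarrow> nat" where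
  "bcost (NLess e1 e2) = 1 + ncost e1 + ncost e2"
| "bcost (RLess r1 r2) = 1 + rcost r1 + rcost r2"
| "bcost (BNot b) = 1 + bcost b"
| "bcost (BAnd b1 b2) = 1 + bcost b1 + bcost b2"

definition nupd :: "store \<Rightarrow> nat \<Rightarrow> nat \<Rightarrow> nat \<Rightarrow> store" where
  "nupd s a k n = ((fst s)(a := (fst s a)(k := n)), snd s)"

definition rupd :: "store \<Rightarrow> nat \<Rightarrow> nat \<Rightarrow> real \<Rightarrow> store" where
  "rupd s a k r = (fst s, (snd s)(a := (snd s a)(k := r)))"

text \<open>\<open>exec c s t s'\<close>: started in store \<open>s\<close>, the program \<open>c\<close> halts after exactly \<open>t\<close> elementary
  operations in store \<open>s'\<close>.\<close>

inductive exec :: "com \<Rightarrow> store \<Rightarrow> nat \<Rightarrow> store \<Rightarrow> bool" where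
  Skip: "exec SKIP s 1 s"
| NAssign: "exec (NAssign a e e') s (1 + ncost e + ncost e') (nupd s a (nval e s) (nval e' s))"
| RAssign: "exec (RAssign a e r) s (1 + ncost e + rcost r) (rupd s a (nval e s) (rval r s))"
| Seq: "exec c1 s1 t1 s2 \<Longrightarrow> exec c2 s2 t2 s3 \<Longrightarrow> exec (Seq c1 c2) s1 (t1 + t2) s3"
| CondTrue: "bval b s \<Longrightarrow> exec c1 s t s' \<Longrightarrow> exec (Cond b c1 c2) s (1 + bcost b + t) s'"
| CondFalse: "\<not> bval b s \<Longrightarrow> exec c2 s t s' \<Longrightarrow> exec (Cond b c1 c2) s (1 + bcost b + t) s'"
| WhileFalse: "\<not> bval b s \<Longrightarrow> exec (While b c) s (1 + bcost b) s"
| WhileTrue: "bval b s1 \<Longrightarrow> exec c s1 t1 s2 \<Longrightarrow> exec (While b c) s2 t2 s3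
    \<Longrightarrow> exec (While b c) s1 (1 + bcost b + t1 + t2) s3"

lemma exec_deterministic:
  "exec c s t s' \<Longrightarrow> exec c s u s'' \<Longrightarrow> u = t \<and> s'' = s'"
proof (induction arbitrary: u s'' rule: exec.induct)
  case (Skip s)
  then show ?case by cases simp
next
  case (NAssign a e e' s)
  then show ?case by cases simp
next
  case (RAssign a e r s)
  then show ?case by cases simp
next
  case (Seq c1 s1 t1 s2 c2 t2 s3)
  from Seq.prems show ?case by cases (use Seq.IH in blast)
next
  case (CondTrue b s c1 t s' c2)
  from CondTrue.prems show ?case by cases (use CondTrue.hyps CondTrue.IH in blast)+
next
  case (CondFalse b s c2 t s' c1)
  from CondFalse.prems show ?case by cases (use CondFalse.hyps CondFalse.IH in blast)+
next
  case (WhileFalse b s c)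
  from WhileFalse.prems show ?case by cases (use WhileFalse.hyps in blast)+
next
  case (WhileTrue b s1 c t1 s2 t2 s3)
  from WhileTrue.prems show ?case by cases (use WhileTrue.hyps(1) WhileTrue.IH in blast)+
qed

text \<open>The result of a computation with a real number as output is left in cell 0 of the real
  array 0. A function problem is given by its set of instances, their size, their encoding as an
  initial store, and the function to be computed.\<close>

definition result :: "store \<Rightarrow> real" where
  "result s = snd s 0 0"

definition in_FP :: "'a set \<Rightarrow> ('a \<Rightarrow> nat) \<Rightarrow> ('a \<Rightarrow> store) \<Rightarrow> ('a \<Rightarrow> real) \<Rightarrow> bool" where
  "in_FP I sz enc f \<longleftrightarrow>
     (\<exists>(c :: com) (q :: nat poly). \<forall>a\<in>I. \<exists>t s'.
        exec c (enc a) t s' \<and> t \<le> poly q (sz a) \<and> result s' = f a)"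


section \<open>The problem SHAP(DT, MARKOV)\<close>

text \<open>An instance is \<open>(N, T, x, i, p, K)\<close>: dimension, decision tree, point, feature, and the
  parameters of the Markovian distribution.\<close>

type_synonym shap_instance =
  "nat \<times> dtree \<times> (nat \<Rightarrow> bool) \<times> nat \<times> bool pmf \<times> (nat \<Rightarrow> bool \<Rightarrow> bool pmf)"

definition shap_instances :: "shap_instance set" where
  "shap_instances = {(N, T, x, i, p, K).
     N \<ge> 1 \<and> T \<in> DT N \<and> x \<in> cube N \<and> i \<in> {1..N} \<and> positive_params N p K}"

fun shap_size :: "shap_instance \<Rightarrow> nat" where
  "shap_size (N, T, x, i, p, K) = dt_size T + N"

fun shap_markov :: "shap_instance \<Rightarrow> real" where
  "shap_markov (N, T, x, i, p, K) = shap N (dt_fun T) x i (markov N p K)"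

text \<open>Trees are written in prefix notation; the numbers of variables are positive, so that 0 marks a
  leaf. The natural arrays 0, 1, 2 initially hold \<open>N, i\<close>, the bits of \<open>x\<close>, and the tree; the real
  array 0 holds the two entries of \<open>P\<^sub>i\<^sub>n\<^sub>i\<^sub>t\<close> followed by the four entries of each \<open>P\<^sub>j\<close>, row by row.
  All other cells are 0.\<close>

primrec dt_code :: "dtree \<Rightarrow> nat list" where
  "dt_code (Leaf b) = [0, of_bool b]"
| "dt_code (Node v T0 T1) = v # dt_code T0 @ dt_code T1"

definition markov_code :: "nat \<Rightarrow> bool pmf \<Rightarrow> (nat \<Rightarrow> bool \<Rightarrow> bool pmf) \<Rightarrow> real list" where
  "markov_code N p K =
     [pmf p False, pmf p True] @
     concat (map (\<lambda>j. [pmf (K j False) False, pmf (K j False) True,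
                       pmf (K j True) False, pmf (K j True) True]) [1..<N])"

definition load :: "'a::zero list list \<Rightarrow> nat \<Rightarrow> nat \<Rightarrow> 'a" where
  "load xss a k = (if a < length xss \<and> k < length (xss ! a) then xss ! a ! k else 0)"

fun shap_code :: "shap_instance \<Rightarrow> store" where
  "shap_code (N, T, x, i, p, K) =
     (load [[N, i], map (\<lambda>j. of_bool (x j)) [1..<N+1], dt_code T], load [markov_code N p K])"

end

theory Submission
  imports Defs
begin

text \<open>The score is linear in the model, so it splits into one summand per leaf labelled 1. For a leaf,
  the model is a product of weights \<open>w\<^sub>j(X\<^sub>j)\<close> in \<open>{0,1}\<close>, and by the Markov property its conditional
  expectation given \<open>X\<^sub>S = x\<^sub>S\<close> is a product, over consecutive elements \<open>s < t\<close> of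
  \<open>S \<union> {0, N + 1}\<close>, of ratios that only depend on \<open>s\<close> and \<open>t\<close>. Hence the sum over all \<open>S\<close> with a
  given number of elements is a sum over paths, computed by dynamic programming over the last
  element and the number of elements; sets that avoid \<open>i\<close> get a minus sign from the step that
  jumps over \<open>i\<close>.\<close>

subsection \<open>Bounded execution\<close>

text \<open>Conditioning divides by P(X_S = x_S), which differs from one set S to the next and so
  cannot be pulled out of the sum over the 2^N sets. The dynamic program survives because this
  normalising constant factors over the same pairs of consecutive elements as the numerator: it is
  the numerator with all weights equal to 1. The division can therefore be done step by step.

  Counting only the elements other than i gives S and its partner without i the same count, and
  hence the same coefficient, so that the last element and this count are all a table has to
  remember.

  A leaf costs O(N^3) operations. The weights at a child node are those of its parent with one entry
  cleared, so a stack of weight vectors can follow the tree in prefix order without recursion. The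
  time bound is read off the syntax: loops are nested to a fixed depth, and each run of a loop makes
  linearly many turns.\<close>

primrec nmods :: "com \<Rightarrow> nat set" where
  "nmods SKIP = {}"
| "nmods (NAssign a e e') = {a}"
| "nmods (RAssign a e r) = {}"
| "nmods (Seq c1 c2) = nmods c1 \<union> nmods c2"
| "nmods (Cond b c1 c2) = nmods c1 \<union> nmods c2"
| "nmods (While b c) = nmods c"

primrec rmods :: "com \<Rightarrow> nat set" where
  "rmods SKIP = {}"
| "rmods (NAssign a e e') = {}"
| "rmods (RAssign a e r) = {a}"
| "rmods (Seq c1 c2) = rmods c1 \<union> rmods c2"
| "rmods (Cond b c1 c2) = rmods c1 \<union> rmods c2"
| "rmods (While b c) = rmods c"

text \<open>Array names are fixed in the syntax and only indices are computed, so the arrays that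
  may change can be read off the text of the program.\<close>

lemma exec_frame:
  assumes "exec c s t s'"
  shows "(\<forall>a. a \<notin> nmods c \<longrightarrow> fst s' a = fst s a) \<and> (\<forall>a. a \<notin> rmods c \<longrightarrow> snd s' a = snd s a)"
  using assms by induction (auto simp: nupd_def rupd_def)

text \<open>The value of \<open>time_poly c\<close> at \<open>n\<close> bounds every run of \<open>c\<close> in which each single execution of
  a loop makes at most \<open>n\<close> iterations.\<close>

primrec time_poly :: "com \<Rightarrow> nat poly" where
  "time_poly SKIP = 1"
| "time_poly (NAssign a e e') = [:1 + ncost e + ncost e':]"
| "time_poly (RAssign a e r) = [:1 + ncost e + rcost r:]"
| "time_poly (Seq c1 c2) = time_poly c1 + time_poly c2"
| "time_poly (Cond b c1 c2) = [:1 + bcost b:] + time_poly c1 + time_poly c2"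
| "time_poly (While b c) = [:1, 1:] * ([:1 + bcost b:] + time_poly c)"

text \<open>Total correctness together with a time bound. As the bound depends on \<open>c\<close>
  and \<open>n\<close> only, it composes without any reasoning about time in the correctness
  proofs.\<close>

definition wp :: "nat \<Rightarrow> com \<Rightarrow> (store \<Rightarrow> bool) \<Rightarrow> store \<Rightarrow> bool" where
  "wp n c Q s \<longleftrightarrow> (\<exists>t s'. exec c s t s' \<and> t \<le> poly (time_poly c) n \<and> Q s')"

text \<open>Consequence rule with the frame built in: specifications mention only what changes, and
  the untouched arrays are recovered here.\<close>

lemma wp_mono:
  assumes "wp n c Q s"
    and "\<And>s'. Q s' \<Longrightarrow> (\<And>a. a \<notin> nmods c \<Longrightarrow> fst s' a = fst s a) \<Longrightarrow>
      (\<And>a. a \<notin> rmods c \<Longrightarrow> snd s' a = snd s a) \<Longrightarrow> R s'"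
  shows "wp n c R s"
  using assms exec_frame unfolding wp_def by blast

lemma wp_SKIP: "Q s \<Longrightarrow> wp n SKIP Q s"
  unfolding wp_def using exec.Skip by fastforce

lemma wp_NAssign: "Q (nupd s a (nval e s) (nval e' s)) \<Longrightarrow> wp n (NAssign a e e') Q s"
  unfolding wp_def using exec.NAssign by fastforce

lemma wp_RAssign: "Q (rupd s a (nval e s) (rval r s)) \<Longrightarrow> wp n (RAssign a e r) Q s"
  unfolding wp_def using exec.RAssign by fastforce

lemma wp_Seq: "wp n c1 (wp n c2 Q) s \<Longrightarrow> wp n (Seq c1 c2) Q s"
  unfolding wp_def by (fastforce intro: exec.Seq add_mono)

lemma wp_Cond:
  assumes "bval b s \<Longrightarrow> wp n c1 Q s" and "\<not> bval b s \<Longrightarrow> wp n c2 Q s"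
  shows "wp n (Cond b c1 c2) Q s"
proof (cases "bval b s")
  case True
  then obtain t s' where "exec c1 s t s'" "t \<le> poly (time_poly c1) n" "Q s'"
    using assms unfolding wp_def by blast
  with True show ?thesis unfolding wp_def
    by (intro exI[of _ "1 + bcost b + t"] exI[of _ s']) (use exec.CondTrue in fastforce)
next
  case False
  then obtain t s' where "exec c2 s t s'" "t \<le> poly (time_poly c2) n" "Q s'"
    using assms unfolding wp_def by blast
  with False show ?thesis unfolding wp_def
    by (intro exI[of _ "1 + bcost b + t"] exI[of _ s']) (use exec.CondFalse in fastforce)
qed

text \<open>The index \<open>m\<close> bounds the number of turns still to come. The failing last
  test is charged like a further turn, whence the factor \<open>1 + m\<close>, and
  \<open>[:1, 1:]\<close> in \<open>time_poly\<close>.\<close>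

lemma wp_While:
  assumes "I m s" and "m \<le> n"
    and step: "\<And>m s. I m s \<Longrightarrow> bval b s \<Longrightarrow> \<exists>m'. m = Suc m' \<and> wp n c (I m') s"
    and exit: "\<And>m s. I m s \<Longrightarrow> \<not> bval b s \<Longrightarrow> Q s"
  shows "wp n (While b c) Q s"
proof -
  let ?B = "1 + bcost b + poly (time_poly c) n"
  have "\<exists>t s'. exec (While b c) s t s' \<and> t \<le> (1 + m) * ?B \<and> Q s'"
    using assms(1)
  proof (induction m arbitrary: s)
    case 0
    with step have b: "\<not> bval b s" by blast
    show ?case
      by (intro exI[of _ "1 + bcost b"] exI[of _ s])
        (use 0 exit[OF _ b] exec.WhileFalse[OF b] in auto)
  next
    case (Suc m)
    show ?case
    proof (cases "bval b s")
      case True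
      with step Suc.prems have "wp n c (I m) s" by blast
      then obtain t1 s1 where s1: "exec c s t1 s1" "t1 \<le> poly (time_poly c) n" "I m s1"
        unfolding wp_def by blast
      from Suc.IH[OF s1(3)] obtain t2 s2
        where s2: "exec (While b c) s1 t2 s2" "t2 \<le> (1 + m) * ?B" "Q s2" by blast
      show ?thesis
        by (intro exI[of _ "1 + bcost b + t1 + t2"] exI[of _ s2] conjI
            exec.WhileTrue[OF True s1(1) s2(1)] s2(3)) (use s1(2) s2(2) in simp)
    next
      case False
      show ?thesis
        by (intro exI[of _ "1 + bcost b"] exI[of _ s])
          (use Suc.prems exit[OF _ False] exec.WhileFalse[OF False] in auto)
    qed
  qed
  then obtain t s' where *: "exec (While b c) s t s'" "t \<le> (1 + m) * ?B" "Q s'"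
    by blast
  have "(1 + m) * ?B \<le> (1 + n) * ?B"
    using assms(2) by (intro mult_right_mono) auto
  with * show ?thesis unfolding wp_def
    by (intro exI[of _ t] exI[of _ s']) (auto simp: algebra_simps)
qed

lemma fst_nupd: "fst (nupd s a k n) = (fst s)(a := (fst s a)(k := n))"
  and snd_nupd: "snd (nupd s a k n) = snd s"
  and fst_rupd: "fst (rupd s a k r) = fst s"
  and snd_rupd: "snd (rupd s a k r) = (snd s)(a := (snd s a)(k := r))"
  by (simp_all add: nupd_def rupd_def)

lemmas upd_simps = fst_nupd snd_nupd fst_rupd snd_rupd

subsection \<open>Sums over subsets as sums over paths\<close>

text \<open>Here \<open>s\<close> is the largest element of the set, with \<open>s = 0\<close> for the empty set.\<close>

lemma sum_Pow_max:
  fixes f :: "nat set \<Rightarrow> real"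
  assumes "t > 0"
  shows "(\<Sum>S\<in>Pow {1..<t}. f S) = (\<Sum>s<t. \<Sum>S\<in>Pow {1..<s}. f (insert s S - {0}))"
  using assms
proof (induction t rule: nat_induct_non_zero)
  case 1
  then show ?case by simp
next
  case (Suc t)
  have eq: "{1..<Suc t} = insert t {1..<t}" using Suc.hyps by auto
  have inj: "inj_on (insert t) (Pow {1..<t})"
    by (rule inj_onI) (auto simp: insert_ident subset_iff)
  have "(\<Sum>S\<in>Pow {1..<Suc t}. f S) = (\<Sum>S\<in>Pow {1..<t}. f S) + (\<Sum>S\<in>Pow {1..<t}. f (insert t S))"
    unfolding eq Pow_insert
    by (subst sum.union_disjoint) (use inj in \<open>auto simp: sum.reindex dest: equalityD1\<close>)
  \<comment> \<open>Removing 0 matters only for \<open>s = 0\<close>, where it turns the singleton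
    {0} into the empty set; here it changes nothing.\<close>
  also have "(\<Sum>S\<in>Pow {1..<t}. f (insert t S)) = (\<Sum>S\<in>Pow {1..<t}. f (insert t S - {0}))"
  proof (rule sum.cong)
    fix S assume "S \<in> Pow {1..<t}"
    then have "insert t S - {0} = insert t S" using Suc.hyps by auto
    then show "f (insert t S) = f (insert t S - {0})" by simp
  qed simp
  finally show ?case using Suc.IH by simp
qed

text \<open>\<open>kr t a b\<close> is the probability of moving from \<open>X\<^bsub>t-1\<^esub> = a\<close> to \<open>X\<^sub>t = b\<close>, where the chain starts in
  the fictitious variable \<open>X\<^sub>0 = 1\<close>. Then \<open>fwd\<close> is the total weight of the trajectories
  that end in \<open>X\<^sub>t = b\<close> and agree with \<open>x\<close> on \<open>S\<close>, and \<open>seg\<close> that of the trajectories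
  from \<open>X\<^sub>s = x\<^sub>s\<close> to \<open>X\<^bsub>s+n\<^esub> = b\<close>.\<close>

primrec fwd :: "(nat \<Rightarrow> bool \<Rightarrow> bool \<Rightarrow> real) \<Rightarrow> (nat \<Rightarrow> bool) \<Rightarrow> (nat \<Rightarrow> bool \<Rightarrow> real) \<Rightarrow> nat set
    \<Rightarrow> nat \<Rightarrow> bool \<Rightarrow> real" where
  "fwd kr x w S 0 b = of_bool b"
| "fwd kr x w S (Suc t) b =
    (fwd kr x w S t False * kr (Suc t) False b + fwd kr x w S t True * kr (Suc t) True b)
    * w (Suc t) b * of_bool (Suc t \<in> S \<longrightarrow> b = x (Suc t))"

primrec seg :: "(nat \<Rightarrow> bool \<Rightarrow> bool \<Rightarrow> real) \<Rightarrow> (nat \<Rightarrow> bool) \<Rightarrow> (nat \<Rightarrow> bool \<Rightarrow> real) \<Rightarrow> nat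
    \<Rightarrow> nat \<Rightarrow> bool \<Rightarrow> real" where
  "seg kr x w s 0 b = of_bool (b = x s)"
| "seg kr x w s (Suc n) b =
    (seg kr x w s n False * kr (Suc (s + n)) False b + seg kr x w s n True * kr (Suc (s + n)) True b)
    * w (Suc (s + n)) b"

text \<open>For a Markov chain this is the conditional expectation of the product of the weights
  with index in (s, t], given the values of both end points.\<close>

definition seg_ratio where
  "seg_ratio kr x w s t = seg kr x w s (t - s) (x t) / seg kr x (\<lambda>_ _. 1) s (t - s) (x t)"

definition fwd_ratio where
  "fwd_ratio kr x w S t = fwd kr x w S t (x t) / fwd kr x (\<lambda>_ _. 1) S t (x t)"

lemma fwd_cong:
  "(\<And>j. 0 < j \<Longrightarrow> j \<le> t \<Longrightarrow> j \<in> S \<longleftrightarrow> j \<in> S') \<Longrightarrow> fwd kr x w S t b = fwd kr x w S' t b"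
  by (induction t arbitrary: b) auto

text \<open>Markov property: every trajectory counted passes through \<open>x s\<close> at time s,
  and its weight splits there into past and future. For \<open>s = 0\<close> this is the start in
  state 1, which is why \<open>x 0\<close> is assumed.\<close>

lemma fwd_insert:
  assumes "S \<subseteq> {1..<s}" "x 0"
  shows "fwd kr x w (insert s S - {0}) (s + n) b = fwd kr x w S s (x s) * seg kr x w s n b"
proof (induction n arbitrary: b)
  case 0
  show ?case
  proof (cases s)
    case (Suc s')
    have "fwd kr x w (insert s S - {0}) s' b = fwd kr x w S s' b" for b
      by (rule fwd_cong) (auto simp: Suc)
    moreover have "Suc s' \<notin> S" using assms Suc by auto
    ultimately show ?thesis by (cases "b = x (Suc s')") (simp_all add: Suc)
  qed (use assms in simp)
next
  case (Suc n)
  have "Suc (s + n) \<notin> insert s S - {0}" using assms by auto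
  then show ?case by (simp add: Suc) (simp add: algebra_simps)
qed

text \<open>Numerator and denominator factor at the same place, and with \<open>r / 0 = 0\<close> a
  quotient of products is always the product of the quotients.\<close>

lemma fwd_ratio_insert:
  assumes "S \<subseteq> {1..<s}" "x 0" "s < t"
  shows "fwd_ratio kr x w (insert s S - {0}) t = fwd_ratio kr x w S s * seg_ratio kr x w s t"
  using fwd_insert[where S = S and s = s and x = x and n = "t - s"] assms
  by (simp add: fwd_ratio_def seg_ratio_def)

text \<open>As long as t \<le> i, the path has not skipped i and the sign stays 1.\<close>

definition path_sign :: "nat \<Rightarrow> nat \<Rightarrow> nat set \<Rightarrow> real" where
  "path_sign i t S = (if i < t \<and> i \<notin> S then -1 else 1)"

text \<open>A path consists of its end point t and the set S of earlier elements. The count leaves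
  out 0, which only marks the start, and i, since the coefficients depend on the other elements
  alone.\<close>

definition path_sum where
  "path_sum kr x w i t k =
    (\<Sum>S\<in>Pow {1..<t}. of_bool (card (insert t S - {0, i}) = k) * path_sign i t S * fwd_ratio kr x w S t)"

text \<open>The share of the paths whose last step leads from s to t. A step onto i leaves the count
  as it is.\<close>

definition path_step where
  "path_step kr x w i s t k =
    (if t = i then path_sum kr x w i s k else if k = 0 then 0 else path_sum kr x w i s (k - 1))
    * ((if s < i \<and> i < t then -1 else 1) * seg_ratio kr x w s t)"

lemma path_sum_0: "x 0 \<Longrightarrow> path_sum kr x w i 0 k = of_bool (k = 0)"
  by (simp add: path_sum_def path_sign_def fwd_ratio_def)

text \<open>Group the sets by their largest element s. Count, sign and ratio then each change by an
  amount that depends only on s, t and i.\<close>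

lemma path_sum_rec:
  assumes "x 0" "t > 0" "i > 0"
  shows "path_sum kr x w i t k = (\<Sum>s<t. path_step kr x w i s t k)"
proof -
  have "(\<Sum>S\<in>Pow {1..<s}. of_bool (card (insert t (insert s S - {0}) - {0, i}) = k)
          * path_sign i t (insert s S - {0}) * fwd_ratio kr x w (insert s S - {0}) t)
      = path_step kr x w i s t k" if "s < t" for s
  proof -
    have "of_bool (card (insert t (insert s S - {0}) - {0, i}) = k)
          * path_sign i t (insert s S - {0}) * fwd_ratio kr x w (insert s S - {0}) t
      = of_bool (card (insert s S - {0, i}) + of_bool (t \<noteq> i) = k) * path_sign i s S
          * fwd_ratio kr x w S s * ((if s < i \<and> i < t then -1 else 1) * seg_ratio kr x w s t)"
      if S: "S \<subseteq> {1..<s}" for S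
    proof -
      define A where "A = insert s S - {0, i}"
      have "finite A" using S finite_subset by (auto simp: A_def)
      moreover have "t \<notin> A" using S \<open>s < t\<close> by (auto simp: A_def)
      moreover have "insert t (insert s S - {0}) - {0, i} = (if t = i then A else insert t A)"
        unfolding A_def using \<open>t > 0\<close> by (cases "t = i") (simp_all, blast+)
      ultimately have card: "card (insert t (insert s S - {0}) - {0, i})
          = card (insert s S - {0, i}) + of_bool (t \<noteq> i)"
        unfolding A_def[symmetric] by simp
      have sign: "path_sign i t (insert s S - {0})
          = path_sign i s S * (if s < i \<and> i < t then -1 else 1)"
        using S assms \<open>s < t\<close> by (auto simp: path_sign_def)
      show ?thesis
        unfolding card sign fwd_ratio_insert[where S = S and s = s and x = x and t = t, OF S assms(1) \<open>s < t\<close>]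
        by (simp add: mult_ac)
    qed
    then have "(\<Sum>S\<in>Pow {1..<s}. of_bool (card (insert t (insert s S - {0}) - {0, i}) = k)
          * path_sign i t (insert s S - {0}) * fwd_ratio kr x w (insert s S - {0}) t)
      = (\<Sum>S\<in>Pow {1..<s}. of_bool (card (insert s S - {0, i}) + of_bool (t \<noteq> i) = k)
          * path_sign i s S * fwd_ratio kr x w S s)
          * ((if s < i \<and> i < t then -1 else 1) * seg_ratio kr x w s t)"
      unfolding sum_distrib_right by (intro sum.cong) auto
    also have "\<dots> = path_step kr x w i s t k"
      by (cases k) (auto simp: path_step_def path_sum_def)
    finally show ?thesis .
  qed
  then show ?thesis
    unfolding path_sum_def by (subst sum_Pow_max) (use assms in auto)
qed

subsection \<open>SHAP scores as sums over paths\<close>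

definition cube_mass where
  "cube_mass N p K x g S =
    (\<Sum>z\<in>cube N. markov_weight N p K z * g z * of_bool (\<forall>j\<in>{1..N}. j \<in> S \<longrightarrow> z j = x j))"

definition cond_mean where
  "cond_mean N p K x g S = cube_mass N p K x g S / cube_mass N p K x (\<lambda>_. 1) S"

definition weight_prod :: "nat \<Rightarrow> (nat \<Rightarrow> bool \<Rightarrow> real) \<Rightarrow> (nat \<Rightarrow> bool) \<Rightarrow> real" where
  "weight_prod N w z = (\<Prod>j = 1..N. w j (z j))"

lemma markov_weight_pos:
  assumes "positive_params N p K"
  shows "markov_weight N p K z > 0"
  using assms unfolding markov_weight_def positive_params_def
  by (intro mult_pos_pos prod_pos) auto

lemma expectation_markov:
  assumes "N \<ge> 1"
  shows "measure_pmf.expectation (markov N p K) g = (\<Sum>z\<in>cube N. markov_weight N p K z * g z)"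
proof -
  have "measure_pmf.expectation (markov N p K) g = (\<Sum>z\<in>cube N. pmf (markov N p K) z *\<^sub>R g z)"
    by (rule integral_measure_pmf[OF finite_cube])
      (use assms in \<open>auto simp: set_pmf_iff pmf_markov split: if_splits\<close>)
  then show ?thesis using assms by (simp add: pmf_markov)
qed

lemma shap_value_markov:
  assumes "N \<ge> 1" "positive_params N p K" "x \<in> cube N" "S \<subseteq> {1..N}"
  shows "shap_value g x (markov N p K) S = cond_mean N p K x g S"
proof -
  let ?A = "{z. \<forall>j\<in>S. z j = x j}" and ?P = "markov N p K"
  have ag: "z \<in> ?A \<longleftrightarrow> (\<forall>j\<in>{1..N}. j \<in> S \<longrightarrow> z j = x j)" for z
    using assms(4) by auto
  \<comment> \<open>Positivity of the parameters enters here: x itself has positive mass, so the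
    conditioning event is not null and \<open>cond_pmf\<close> is meaningful.\<close>
  have "x \<in> set_pmf ?P"
    using assms markov_weight_pos[OF assms(2), of x] by (auto simp: set_pmf_iff pmf_markov)
  then have ne: "set_pmf ?P \<inter> ?A \<noteq> {}" by auto
  have meas: "measure ?P ?A = cube_mass N p K x (\<lambda>_. 1) S"
    using expectation_markov[OF assms(1), of p K "indicat_real ?A"] ag
    by (simp add: cube_mass_def indicator_def of_bool_def)
  have "shap_value g x ?P S = (\<Sum>z\<in>cube N. pmf (cond_pmf ?P ?A) z *\<^sub>R g z)"
    unfolding shap_value_def
    by (rule integral_measure_pmf[OF finite_cube])
      (use assms ne in \<open>auto simp: set_cond_pmf set_pmf_iff pmf_markov split: if_splits\<close>)
  also have "\<dots> = (\<Sum>z\<in>cube N. markov_weight N p K z * g z * of_bool (z \<in> ?A) / measure ?P ?A)"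
    by (intro sum.cong refl) (use assms in \<open>auto simp: pmf_cond[OF ne] pmf_markov\<close>)
  also have "\<dots> = cond_mean N p K x g S"
    unfolding meas cond_mean_def cube_mass_def ag sum_divide_distrib ..
  finally show ?thesis .
qed

text \<open>The coefficient of a set with \<open>k + 1\<close> elements, namely i and
  \<open>k\<close> others. For \<open>k < N - 1\<close> the subtraction is not cut off.\<close>

definition shap_coeff :: "nat \<Rightarrow> nat \<Rightarrow> real" where
  "shap_coeff N k = fact (k + 1) * fact (N - k - 2) / fact N"

text \<open>A set \<open>S\<close> not containing \<open>i\<close> contributes to the SHAP score through \<open>S \<union> {i}\<close>, with the
  opposite sign and the weight belonging to the size of \<open>S \<union> {i}\<close>.\<close>

definition shap_sum where
  "shap_sum N p K x i g = (\<Sum>k<N - 1. shap_coeff N k *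
    (\<Sum>S\<in>Pow {1..N}. of_bool (card (S - {i}) = k) * path_sign i (Suc N) S * cond_mean N p K x g S))"

lemma sum_Pow_split:
  fixes h :: "nat set \<Rightarrow> real"
  assumes "finite A" "i \<in> A"
  shows "(\<Sum>S\<in>Pow A. h S) = (\<Sum>S\<in>Pow (A - {i}). h (insert i S) + h S)"
proof -
  have A: "A = insert i (A - {i})" using assms by auto
  have inj: "inj_on (insert i) (Pow (A - {i}))"
    by (rule inj_onI) (auto simp: insert_ident subset_iff)
  have "(\<Sum>S\<in>Pow A. h S) = (\<Sum>S\<in>Pow (A - {i}). h S) + (\<Sum>S\<in>insert i ` Pow (A - {i}). h S)"
    by (subst A, subst Pow_insert, subst sum.union_disjoint) (use assms in auto)
  then show ?thesis by (simp add: sum.reindex[OF inj] sum.distrib)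
qed

lemma shap_eq_shap_sum:
  assumes "N \<ge> 1" "positive_params N p K" "x \<in> cube N" "i \<in> {1..N}"
  shows "shap N g x i (markov N p K) = shap_sum N p K x i g"
proof -
  let ?v = "cond_mean N p K x g"
  \<comment> \<open>The summands \<open>h\<close> and \<open>l\<close> differ set by set, but have
    the same sum over each pair of S and S \<union> {i}: for i outside S, \<open>l S\<close>
    vanishes, while \<open>h S\<close> supplies the negative half.\<close>
  define h where "h S = of_bool (card (S - {i}) < N - 1) * shap_coeff N (card (S - {i}))
    * path_sign i (Suc N) S * ?v S" for S
  define l where "l S = of_bool (S \<noteq> {1..N}) * (fact (card S) * fact (N - card S - 1) / fact N
    * (?v S - ?v (S - {i})))" for S :: "nat set"
  have "shap_sum N p K x i g = (\<Sum>S\<in>Pow {1..N}. \<Sum>k<N - 1. of_bool (card (S - {i}) = k) *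
      (shap_coeff N k * path_sign i (Suc N) S * ?v S))"
    unfolding shap_sum_def sum_distrib_left by (subst sum.swap) (simp add: mult_ac)
  also have "\<dots> = (\<Sum>S\<in>Pow {1..N}. h S)"
  proof (rule sum.cong[OF refl])
    fix S
    have "(\<Sum>k<N - 1. of_bool (card (S - {i}) = k) * (shap_coeff N k * path_sign i (Suc N) S * ?v S))
      = (\<Sum>k<N - 1. if card (S - {i}) = k then shap_coeff N k * path_sign i (Suc N) S * ?v S else 0)"
      by (rule sum.cong) auto
    also have "\<dots> = h S" unfolding sum.delta'[OF finite_lessThan] by (simp add: h_def)
    finally show "(\<Sum>k<N - 1. of_bool (card (S - {i}) = k)
      * (shap_coeff N k * path_sign i (Suc N) S * ?v S)) = h S" .
  qed
  also have "\<dots> = (\<Sum>S\<in>Pow ({1..N} - {i}). h (insert i S) + h S)"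
    by (rule sum_Pow_split) (use assms in auto)
  also have "\<dots> = (\<Sum>S\<in>Pow ({1..N} - {i}). l (insert i S) + l S)"
  proof (rule sum.cong[OF refl])
    fix S assume S: "S \<in> Pow ({1..N} - {i})"
    then have fin: "finite S" and i: "i \<notin> S" "i < Suc N"
      using finite_subset assms by auto
    have "card S \<le> N - 1" using S assms card_mono[of "{1..N} - {i}" S] by auto
    \<comment> \<open>The pair containing the full set, which the score excludes, is exactly the one
      that the bound \<open>k < N - 1\<close> drops.\<close>
    moreover have "card S = N - 1 \<longleftrightarrow> insert i S = {1..N}"
    proof
      assume "card S = N - 1"
      then have "S = {1..N} - {i}" using S assms by (intro card_subset_eq) auto
      then show "insert i S = {1..N}" using assms by auto
    next
      assume "insert i S = {1..N}"
      then show "card S = N - 1" using fin i card_insert_disjoint[OF fin i(1)] by simp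
    qed
    ultimately have lt: "card S < N - 1 \<longleftrightarrow> insert i S \<noteq> {1..N}" by linarith
    have del: "insert i S - {i} = S" "S - {i} = S" using i by auto
    have "h (insert i S) + h S =
        of_bool (card S < N - 1) * (shap_coeff N (card S) * (?v (insert i S) - ?v S))"
      unfolding h_def del using i by (simp add: path_sign_def algebra_simps)
    also have "shap_coeff N (card S) =
        fact (card (insert i S)) * fact (N - card (insert i S) - 1) / fact N"
      using fin i by (simp add: shap_coeff_def)
    also have "of_bool (card S < N - 1) * (\<dots> * (?v (insert i S) - ?v S)) = l (insert i S) + l S"
      unfolding l_def del lt by simp
    finally show "h (insert i S) + h S = l (insert i S) + l S" .
  qed
  also have "\<dots> = (\<Sum>S\<in>Pow {1..N}. l S)"
    by (rule sum_Pow_split[symmetric]) (use assms in auto)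
  also have "\<dots> = (\<Sum>S | S \<subset> {1..N}. l S)"
    by (rule sum.mono_neutral_right) (auto simp: l_def)
  also have "\<dots> = shap N g x i (markov N p K)"
    unfolding shap_def
  proof (rule sum.cong[OF refl])
    fix S assume "S \<in> {S. S \<subset> {1..N}}"
    then have "S \<subset> {1..N}" "S - {i} \<subseteq> {1..N}" by auto
    then show "l S = fact (card S) * fact (N - card S - 1) / fact N *
      (shap_value g x (markov N p K) S - shap_value g x (markov N p K) (S - {i}))"
      using assms by (simp add: l_def shap_value_markov psubset_eq)
  qed
  finally show ?thesis ..
qed

lemma cube_mass_cong:
  "(\<And>z. z \<in> cube N \<Longrightarrow> g z = g' z) \<Longrightarrow> (\<And>j. j \<in> {1..N} \<Longrightarrow> x j = x' j)
    \<Longrightarrow> cube_mass N p K x g S = cube_mass N p K x' g' S"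
  unfolding cube_mass_def by (intro sum.cong) auto

text \<open>The values of x outside {1..N} are free, which leaves room for sentinels at 0 and N +
  1.\<close>

lemma shap_sum_cong:
  "(\<And>z. z \<in> cube N \<Longrightarrow> g z = g' z) \<Longrightarrow> (\<And>j. j \<in> {1..N} \<Longrightarrow> x j = x' j)
    \<Longrightarrow> shap_sum N p K x i g = shap_sum N p K x' i g'"
  unfolding shap_sum_def cond_mean_def
  using cube_mass_cong[of N g g' x x'] cube_mass_cong[of N "\<lambda>_. 1" "\<lambda>_. 1" x x'] by simp

lemma shap_sum_add:
  "shap_sum N p K x i (\<lambda>z. g z + h z) = shap_sum N p K x i g + shap_sum N p K x i h"
  by (simp add: shap_sum_def cond_mean_def cube_mass_def algebra_simps sum.distrib
      add_divide_distrib flip: sum_divide_distrib)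

lemma shap_sum_zero: "shap_sum N p K x i (\<lambda>z. 0) = 0"
  by (simp add: shap_sum_def cond_mean_def cube_mass_def)

text \<open>The chain is extended by a variable \<open>X\<^bsub>N+1\<^esub>\<close> that is forced to be 0 by a step of weight 1.\<close>

definition markov_kernel where
  "markov_kernel N p K kr \<longleftrightarrow> kr 1 True = pmf p \<and> (\<forall>j\<in>{1..<N}. \<forall>a. kr (Suc j) a = pmf (K j a))
    \<and> (\<forall>a. kr (Suc N) a False = 1)"

lemma fwd_eq_sum:
  assumes kr: "markov_kernel N p K kr" and "x 0" and "t \<ge> 1" "t \<le> N"
  shows "fwd kr x w S t b = (\<Sum>z\<in>cube t. of_bool (z t = b) * (markov_weight t p K z * weight_prod t w z
    * of_bool (\<forall>j\<in>{1..t}. j \<in> S \<longrightarrow> z j = x j)))"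
  using assms(3,4)
proof (induction t arbitrary: b rule: nat_induct_at_least)
  case base
  have "cube 0 = {\<lambda>_. undefined}" by (simp add: cube_def)
  \<comment> \<open>The start state 0 has weight 0, so of the first kernel only the row of state 1
    enters.\<close>
  moreover have "kr (Suc 0) True = pmf p" using kr by (simp add: markov_kernel_def)
  ultimately show ?case
    using sum_cube_Suc[of _ 0]
    by (cases b) (simp_all add: markov_weight_def weight_prod_def UNIV_bool)
next
  case (Suc t)
  define A where "A z = markov_weight t p K z * weight_prod t w z
    * of_bool (\<forall>j\<in>{1..t}. j \<in> S \<longrightarrow> z j = x j)" for z
  have kt: "kr (Suc t) a = pmf (K t a)" for a
    using kr Suc by (simp add: markov_kernel_def)
  have wp: "weight_prod (Suc t) w (z(Suc t := b')) = weight_prod t w z * w (Suc t) b'" for z b'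
    unfolding weight_prod_def by (simp cong: prod.cong_simp)
  have ag: "(\<forall>j\<in>{1..Suc t}. j \<in> S \<longrightarrow> (z(Suc t := b')) j = x j) \<longleftrightarrow>
    (\<forall>j\<in>{1..t}. j \<in> S \<longrightarrow> z j = x j) \<and> (Suc t \<in> S \<longrightarrow> b' = x (Suc t))" for z b'
    by (auto simp: atLeastAtMostSuc_conv)
  have "(\<Sum>z\<in>cube (Suc t). of_bool (z (Suc t) = b) * (markov_weight (Suc t) p K z
      * weight_prod (Suc t) w z * of_bool (\<forall>j\<in>{1..Suc t}. j \<in> S \<longrightarrow> z j = x j)))
    = (\<Sum>z\<in>cube t. A z * pmf (K t (z t)) b * w (Suc t) b * of_bool (Suc t \<in> S \<longrightarrow> b = x (Suc t)))"
    unfolding sum_cube_Suc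
  proof (rule sum.cong[OF refl])
    fix z
    have *: "of_bool ((z(Suc t := b')) (Suc t) = b) * (markov_weight (Suc t) p K (z(Suc t := b'))
        * weight_prod (Suc t) w (z(Suc t := b'))
        * of_bool (\<forall>j\<in>{1..Suc t}. j \<in> S \<longrightarrow> (z(Suc t := b')) j = x j))
      = of_bool (b' = b) * (A z * pmf (K t (z t)) b * w (Suc t) b * of_bool (Suc t \<in> S \<longrightarrow> b = x (Suc t)))"
      for b'
      unfolding ag wp markov_weight_Suc[OF Suc.hyps] A_def by (cases "b' = b") auto
    show "(\<Sum>b'\<in>UNIV. of_bool ((z(Suc t := b')) (Suc t) = b) * (markov_weight (Suc t) p K (z(Suc t := b'))
        * weight_prod (Suc t) w (z(Suc t := b'))
        * of_bool (\<forall>j\<in>{1..Suc t}. j \<in> S \<longrightarrow> (z(Suc t := b')) j = x j)))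
      = A z * pmf (K t (z t)) b * w (Suc t) b * of_bool (Suc t \<in> S \<longrightarrow> b = x (Suc t))"
      unfolding * by (cases b) (simp_all add: UNIV_bool)
  qed
  \<comment> \<open>Splitting by the value of \<open>z t\<close> makes the transition probabilities
    constants that can leave the sum, and what remains has the form of the induction
    hypothesis.\<close>
  also have "\<dots> = (\<Sum>z\<in>cube t. (of_bool (z t = False) * A z * pmf (K t False) b
      + of_bool (z t = True) * A z * pmf (K t True) b)
      * w (Suc t) b * of_bool (Suc t \<in> S \<longrightarrow> b = x (Suc t)))"
  proof (rule sum.cong[OF refl])
    fix z
    show "A z * pmf (K t (z t)) b * w (Suc t) b * of_bool (Suc t \<in> S \<longrightarrow> b = x (Suc t)) =
      (of_bool (z t = False) * A z * pmf (K t False) b + of_bool (z t = True) * A z * pmf (K t True) b)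
      * w (Suc t) b * of_bool (Suc t \<in> S \<longrightarrow> b = x (Suc t))"
      by (cases "z t") simp_all
  qed
  also have "\<dots> = ((\<Sum>z\<in>cube t. of_bool (z t = False) * A z) * pmf (K t False) b
      + (\<Sum>z\<in>cube t. of_bool (z t = True) * A z) * pmf (K t True) b)
      * w (Suc t) b * of_bool (Suc t \<in> S \<longrightarrow> b = x (Suc t))"
    by (simp only: sum_distrib_right flip: sum.distrib)
  also have "\<dots> = fwd kr x w S (Suc t) b"
    using Suc.IH Suc.prems unfolding A_def fwd.simps kt by simp
  finally show ?case ..
qed

text \<open>The forced last step has weight 1 from either state, so it sums out the value of
  X_N.\<close>

lemma fwd_eq_cube_mass:
  assumes "markov_kernel N p K kr" "N \<ge> 1" "x 0" "S \<subseteq> {1..N}" "w (Suc N) False = 1"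
  shows "fwd kr x w S (Suc N) False = cube_mass N p K x (weight_prod N w) S"
proof -
  have "Suc N \<notin> S" using assms by auto
  then have "fwd kr x w S (Suc N) False = fwd kr x w S N False + fwd kr x w S N True"
    using assms by (simp add: markov_kernel_def)
  also have "\<dots> = cube_mass N p K x (weight_prod N w) S"
    unfolding fwd_eq_sum[where N = N and t = N and x = x, OF assms(1,3,2) order.refl] cube_mass_def
    by (auto simp flip: sum.distrib intro!: sum.cong)
  finally show ?thesis .
qed

text \<open>The count is \<open>Suc k\<close> because the end point N + 1 is an element of the path
  as well.\<close>

lemma shap_sum_eq_path_sum:
  assumes "markov_kernel N p K kr" "N \<ge> 1" "x 0" "\<not> x (Suc N)" "w (Suc N) False = 1"
    and "i \<in> {1..N}"
  shows "shap_sum N p K x i (weight_prod N w) =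
    (\<Sum>k<N - 1. shap_coeff N k * path_sum kr x w i (Suc N) (Suc k))"
  unfolding shap_sum_def path_sum_def
proof (intro sum.cong refl arg_cong2[where f = "(*)"])
  fix k S
  assume S: "S \<in> Pow {1..<Suc N}"
  have "insert (Suc N) S - {0, i} = insert (Suc N) (S - {i})" "finite (S - {i})" "Suc N \<notin> S - {i}"
    using S assms(6) finite_subset by auto
  then show "of_bool (card (S - {i}) = k) = of_bool (card (insert (Suc N) S - {0, i}) = Suc k)"
    by simp
  have "weight_prod N (\<lambda>_ _. 1) = (\<lambda>_. 1)" by (auto simp: weight_prod_def)
  moreover have "S \<subseteq> {1..N}" using S by auto
  ultimately show "cond_mean N p K x (weight_prod N w) S = fwd_ratio kr x w S (Suc N)"
    using fwd_eq_cube_mass[where x = x and S = S and w = w, OF assms(1-3)]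
      fwd_eq_cube_mass[where x = x and S = S and w = "\<lambda>_ _. 1", OF assms(1-3)] assms(4,5)
    unfolding fwd_ratio_def cond_mean_def by simp
qed (auto simp: atLeastLessThanSuc_atLeastAtMost)

section \<open>Decomposition of the score along the tree\<close>

definition tree_score where
  "tree_score N p K x i T w = shap_sum N p K x i (\<lambda>z. dt_fun T z * weight_prod N w z)"

lemma tree_score_Leaf:
  "tree_score N p K x i (Leaf b) w = (if b then shap_sum N p K x i (weight_prod N w) else 0)"
  by (simp add: tree_score_def dt_fun_def shap_sum_zero)

abbreviation forbid :: "(nat \<Rightarrow> bool \<Rightarrow> real) \<Rightarrow> nat \<Rightarrow> bool \<Rightarrow> nat \<Rightarrow> bool \<Rightarrow> real" where
  "forbid w v b \<equiv> w(v := (w v)(b := 0))"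

lemma weight_prod_forbid:
  assumes "v \<in> {1..N}"
  shows "weight_prod N (forbid w v b) z = (if z v = b then 0 else weight_prod N w z)"
proof (cases "z v = b")
  case True
  then show ?thesis
    unfolding weight_prod_def using assms by (auto intro!: bexI[of _ v])
next
  case False
  then show ?thesis
    unfolding weight_prod_def by (auto intro!: prod.cong split: if_splits)
qed

text \<open>Each point follows one branch, and the weight product of the other branch vanishes
  there. If a variable is tested again with the opposite outcome, both its values are forbidden and
  the contradictory path contributes 0.\<close>

lemma tree_score_Node:
  assumes "v \<in> {1..N}"
  shows "tree_score N p K x i (Node v T0 T1) w =
    tree_score N p K x i T0 (forbid w v True) + tree_score N p K x i T1 (forbid w v False)"
  unfolding tree_score_def shap_sum_add[symmetric]
  by (rule shap_sum_cong) (use assms in \<open>auto simp: dt_fun_def weight_prod_forbid\<close>)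

subsection \<open>The program\<close>

abbreviation (input) seq_com :: "com \<Rightarrow> com \<Rightarrow> com" (infixr ";;" 60) where "c1 ;; c2 \<equiv> Seq c1 c2"
abbreviation "nvar a \<equiv> NCell a (NConst 0)"
abbreviation "rvar a \<equiv> RCell a (NConst 0)"
abbreviation "nset a e \<equiv> NAssign a (NConst 0) e"
abbreviation "rset a r \<equiv> RAssign a (NConst 0) r"
abbreviation "ninc a e \<equiv> NAssign a (NConst 0) (NAdd (NCell a (NConst 0)) e)"

text \<open>Natural arrays (all used as scalars): 3 \<open>pos\<close>, current position in the tree code;
  4 \<open>sp\<close>, start of the topmost weight block; 5 length of a weight block; 6 \<open>s\<close>; 7 \<open>t\<close>; 8 \<open>k\<close>; 9 \<open>j\<close>;
  10 and 11, starts of the rows \<open>s\<close> and \<open>t\<close> of the current table; 12 start of the current table;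
  13 and 14, the bits \<open>x\<^sub>s\<close> and \<open>x\<^sub>t\<close>; 15 increment of the path length; 16 length of a table row.
  Real arrays: 1 stack of weight blocks; 2 tables of path sums; 3 result so far; 4 and 5, the
  vectors \<open>seg\<close> with and without weights; 6 factor of the current step; 7 scratch; 8 factorials;
  9 counter. The table of a leaf is placed behind that of the previous one, so that it need not be
  cleared.\<close>

definition add_row :: com where
  "add_row =
    nset 8 (NConst 0) ;;
    While (NLess (nvar 8) (NAdd (nvar 0) (NConst 1)))
     (RAssign 2 (NAdd (NAdd (nvar 11) (nvar 8)) (nvar 15))
       (RAdd (RCell 2 (NAdd (NAdd (nvar 11) (nvar 8)) (nvar 15)))
             (RMul (RCell 2 (NAdd (nvar 10) (nvar 8))) (rvar 6))) ;;
      ninc 8 (NConst 1))"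

text \<open>The entry \<open>P\<^sub>j(b | a)\<close> is in cell \<open>2 + 4(j - 1) + 2a + b\<close>, and \<open>t = j + 1\<close>. For \<open>t = 1\<close> and \<open>a = 1\<close>
  this formula yields \<open>P\<^sub>i\<^sub>n\<^sub>i\<^sub>t\<close>; for \<open>t = 1\<close> and \<open>a = 0\<close> it is cut off at cell 0, and the entry
  read there is multiplied by 0.\<close>

definition kernel_cell :: "nat \<Rightarrow> rexp" where
  "kernel_cell q = RCell 0 (NSub
    (NAdd (NAdd (NAdd (nvar 7) (nvar 7)) (NAdd (nvar 7) (nvar 7))) (NConst q)) (NConst 6))"

text \<open>Each new entry needs both old ones, hence the detour through the scratch array.\<close>

definition advance :: "nat \<Rightarrow> com" where
  "advance v =
    RAssign 7 (NConst 0) (RAdd (RMul (RCell v (NConst 0)) (kernel_cell 0))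
                               (RMul (RCell v (NConst 1)) (kernel_cell 2))) ;;
    RAssign 7 (NConst 1) (RAdd (RMul (RCell v (NConst 0)) (kernel_cell 1))
                               (RMul (RCell v (NConst 1)) (kernel_cell 3))) ;;
    RAssign v (NConst 0) (RCell 7 (NConst 0)) ;;
    RAssign v (NConst 1) (RCell 7 (NConst 1))"

definition weigh :: com where
  "weigh =
    RAssign 4 (NConst 0) (RMul (RCell 4 (NConst 0))
      (RCell 1 (NAdd (nvar 4) (NAdd (nvar 7) (nvar 7))))) ;;
    RAssign 4 (NConst 1) (RMul (RCell 4 (NConst 1))
      (RCell 1 (NAdd (NAdd (nvar 4) (NAdd (nvar 7) (nvar 7))) (NConst 1))))"

text \<open>For t = N + 1 the bit is read just behind those of x, where \<open>load\<close> leaves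
  the 0 that serves as the sentinel.\<close>

definition step_factor :: com where
  "step_factor =
    nset 14 (NCell 1 (NSub (nvar 7) (NConst 1))) ;;
    rset 6 (RDiv (RCell 4 (nvar 14)) (RCell 5 (nvar 14))) ;;
    Cond (BAnd (NLess (nvar 6) (NCell 0 (NConst 1))) (NLess (NCell 0 (NConst 1)) (nvar 7)))
      (rset 6 (RSub RZero (rvar 6))) SKIP ;;
    Cond (BAnd (BNot (NLess (nvar 7) (NCell 0 (NConst 1)))) (BNot (NLess (NCell 0 (NConst 1)) (nvar 7))))
      (nset 15 (NConst 0)) (nset 15 (NConst 1))"

definition start_paths :: com where
  "start_paths =
    Cond (NLess (NConst 0) (nvar 6)) (nset 13 (NCell 1 (NSub (nvar 6) (NConst 1)))) (nset 13 (NConst 1)) ;;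
    RAssign 4 (NConst 0) RZero ;; RAssign 4 (NConst 1) RZero ;; RAssign 4 (nvar 13) ROne ;;
    RAssign 5 (NConst 0) RZero ;; RAssign 5 (NConst 1) RZero ;; RAssign 5 (nvar 13) ROne"

text \<open>Row s is final once all smaller rows have been distributed. Pushing it forward to all t
  > s lets the \<open>seg\<close> vectors advance by a single transition per t.\<close>

definition extend_paths :: com where
  "extend_paths =
    start_paths ;;
    nset 7 (NAdd (nvar 6) (NConst 1)) ;;
    nset 11 (NAdd (nvar 10) (nvar 16)) ;;
    While (NLess (nvar 7) (NAdd (nvar 0) (NConst 2)))
     (advance 4 ;; weigh ;; advance 5 ;; step_factor ;; add_row ;;
      ninc 7 (NConst 1) ;; ninc 11 (nvar 16))"

definition add_result :: com where
  "add_result =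
    nset 8 (NConst 0) ;;
    While (NLess (NAdd (nvar 8) (NConst 1)) (nvar 0))
     (rset 3 (RAdd (rvar 3) (RMul
        (RDiv (RMul (RCell 8 (NAdd (nvar 8) (NConst 1))) (RCell 8 (NSub (NSub (nvar 0) (nvar 8)) (NConst 2))))
              (RCell 8 (nvar 0)))
        (RCell 2 (NAdd (nvar 10) (NAdd (nvar 8) (NConst 1)))))) ;;
      ninc 8 (NConst 1))"

text \<open>The initial 1 is the path sum of the empty path. The loop leaves array 10 at row N + 1,
  the one that enters the score.\<close>

definition do_leaf :: com where
  "do_leaf =
    RAssign 2 (nvar 12) ROne ;;
    nset 6 (NConst 0) ;;
    nset 10 (nvar 12) ;;
    While (NLess (nvar 6) (NAdd (nvar 0) (NConst 1)))
     (extend_paths ;; ninc 6 (NConst 1) ;; ninc 10 (nvar 16)) ;;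
    add_result ;;
    nset 12 (NAdd (nvar 10) (nvar 16))"

text \<open>The code of the 0-branch comes first in prefix order, so its block is the copy on top,
  and the old block is reused for the 1-branch.\<close>

definition do_node :: com where
  "do_node =
    nset 9 (NConst 0) ;;
    While (NLess (nvar 9) (nvar 5))
     (RAssign 1 (NAdd (NAdd (nvar 4) (nvar 5)) (nvar 9)) (RCell 1 (NAdd (nvar 4) (nvar 9))) ;;
      ninc 9 (NConst 1)) ;;
    RAssign 1 (NAdd (nvar 4) (NAdd (NCell 2 (nvar 3)) (NCell 2 (nvar 3)))) RZero ;;
    RAssign 1 (NAdd (NAdd (NAdd (nvar 4) (nvar 5)) (NAdd (NCell 2 (nvar 3)) (NCell 2 (nvar 3)))) (NConst 1)) RZero ;;
    ninc 4 (nvar 5) ;;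
    ninc 3 (NConst 1)"

definition traverse :: com where
  "traverse =
    While (NLess (NConst 0) (nvar 4))
     (Cond (NLess (NConst 0) (NCell 2 (nvar 3)))
        do_node
        (Cond (NLess (NConst 0) (NCell 2 (NAdd (nvar 3) (NConst 1)))) do_leaf SKIP ;;
         nset 4 (NSub (nvar 4) (nvar 5)) ;;
         ninc 3 (NConst 2)))"

text \<open>By the cell formula for t = N + 1, the cells 4N - 2 and 4N hold the transitions to 0
  from the states 0 and 1: the forced step.\<close>

definition init_params :: com where
  "init_params =
    RAssign 0 (NSub (NAdd (NAdd (nvar 0) (nvar 0)) (NAdd (nvar 0) (nvar 0))) (NConst 2)) ROne ;;
    RAssign 0 (NAdd (NAdd (nvar 0) (nvar 0)) (NAdd (nvar 0) (nvar 0))) ROne ;;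
    nset 5 (NAdd (NAdd (nvar 0) (nvar 0)) (NConst 4)) ;;
    nset 16 (NAdd (nvar 0) (NConst 2))"

text \<open>The machine does not convert naturals to reals, so a real counter runs along with the
  natural one.\<close>

definition init_fact :: com where
  "init_fact =
    RAssign 8 (NConst 0) ROne ;;
    nset 9 (NConst 0) ;;
    While (NLess (nvar 9) (nvar 0))
     (rset 9 (RAdd (rvar 9) ROne) ;;
      RAssign 8 (NAdd (nvar 9) (NConst 1)) (RMul (RCell 8 (nvar 9)) (rvar 9)) ;;
      ninc 9 (NConst 1))"

text \<open>The bottom block starts at its own length rather than at 0, so that
  \<open>sp = 0\<close> can signal the empty stack.\<close>

definition init_block :: com where
  "init_block =
    nset 9 (NConst 0) ;;
    While (NLess (nvar 9) (nvar 5))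
     (RAssign 1 (NAdd (nvar 5) (nvar 9)) ROne ;; ninc 9 (NConst 1)) ;;
    nset 4 (nvar 5)"

definition shap_program :: com where
  "shap_program = init_params ;; init_fact ;; init_block ;; traverse ;; rset 0 (rvar 3)"


subsection \<open>Correctness of the program\<close>

lemmas mods_simps = nmods.simps rmods.simps

text \<open>The update is in place; the last assumption puts the source cells before the target
  cells, so they are read unchanged.\<close>

lemma add_row_correct:
  fixes st :: store
  assumes "fst st 0 0 = N" "N + 1 \<le> n" "fst st 10 0 + N < fst st 11 0 + fst st 15 0"
  shows "wp n add_row (\<lambda>st'. snd st' 2 = (\<lambda>q.
      if fst st 11 0 + fst st 15 0 \<le> q \<and> q \<le> fst st 11 0 + fst st 15 0 + N
      then snd st 2 q + snd st 2 (fst st 10 0 + (q - (fst st 11 0 + fst st 15 0))) * snd st 6 0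
      else snd st 2 q)) st"
proof -
  define u v r D where "u = fst st 10 0" and "v = fst st 11 0 + fst st 15 0" and "r = snd st 6 0"
    and "D = snd st 2"
  define I where "I m st' \<longleftrightarrow> (\<exists>k. m + k = N + 1 \<and> fst st' 8 0 = k \<and> fst st' 0 0 = N
    \<and> fst st' 10 0 = u \<and> fst st' 11 0 = fst st 11 0 \<and> fst st' 15 0 = fst st 15 0 \<and> snd st' 6 0 = r
    \<and> snd st' 2 = (\<lambda>q. if v \<le> q \<and> q < v + k then D q + D (u + (q - v)) * r else D q))"
    for m and st' :: store
  show ?thesis
    unfolding add_row_def
    apply (rule wp_Seq, rule wp_NAssign, rule wp_While[where I = I and m = "N + 1"])
    subgoal by (auto simp: I_def upd_simps u_def v_def r_def D_def assms)
    subgoal using assms by simp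
    subgoal for m st'
      by (cases m) (use assms(3) in \<open>auto simp: I_def upd_simps u_def v_def fun_eq_iff
          intro!: wp_Seq wp_NAssign wp_RAssign\<close>)
    subgoal by (auto simp: I_def u_def v_def r_def D_def fun_eq_iff)
    done
qed

lemma rval_kernel_cell: "rval (kernel_cell q) st = snd st 0 (4 * fst st 7 0 + q - 6)"
proof -
  have "fst st 7 0 + fst st 7 0 + (fst st 7 0 + fst st 7 0) = 4 * fst st 7 0" by simp
  then show ?thesis by (simp only: kernel_cell_def rval.simps nval.simps)
qed

lemma advance_correct:
  assumes "v \<noteq> 0" "v \<noteq> 7"
    and "\<And>a b. snd st 0 (4 * fst st 7 0 + 2 * of_bool a + of_bool b - 6) = kr a b"
    and "\<And>b. snd st v (of_bool b) = f b"
  shows "wp n (advance v) (\<lambda>st'. \<forall>b. snd st' v (of_bool b) = f False * kr False b + f True * kr True b) st"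
  using assms(1,2) assms(3)[of False False] assms(3)[of False True] assms(3)[of True False]
    assms(3)[of True True] assms(4)[of False] assms(4)[of True]
  unfolding advance_def
  by (intro wp_Seq wp_NAssign wp_RAssign) (simp add: upd_simps all_bool_eq rval_kernel_cell)

lemma weigh_correct:
  assumes "\<And>b. snd st 1 (fst st 4 0 + 2 * fst st 7 0 + of_bool b) = w b"
    and "\<And>b. snd st 4 (of_bool b) = f b"
  shows "wp n weigh (\<lambda>st'. \<forall>b. snd st' 4 (of_bool b) = f b * w b) st"
  using assms(1)[of False] assms(1)[of True] assms(2)[of False] assms(2)[of True]
  unfolding weigh_def
  by (intro wp_Seq wp_NAssign wp_RAssign) (simp add: upd_simps all_bool_eq algebra_simps mult_2)

lemma step_factor_correct:
  assumes "fst st 1 (fst st 7 0 - 1) = of_bool xt"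
    and "snd st 4 (of_bool xt) = f" "snd st 5 (of_bool xt) = g"
  shows "wp n step_factor (\<lambda>st'.
    snd st' 6 0 = (if fst st 6 0 < fst st 0 1 \<and> fst st 0 1 < fst st 7 0 then -1 else 1) * (f / g)
    \<and> fst st' 15 0 = of_bool (fst st 7 0 \<noteq> fst st 0 1)) st"
  using assms unfolding step_factor_def
  by (intro wp_Seq wp_NAssign wp_RAssign wp_Cond wp_SKIP) (auto simp: upd_simps)

lemma start_paths_correct:
  assumes "fst st 6 0 = 0 \<Longrightarrow> xs" "fst st 6 0 > 0 \<Longrightarrow> fst st 1 (fst st 6 0 - 1) = of_bool xs"
  shows "wp n start_paths (\<lambda>st'. \<forall>b. snd st' 4 (of_bool b) = of_bool (b = xs)
    \<and> snd st' 5 (of_bool b) = of_bool (b = xs)) st"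
  using assms unfolding start_paths_def
  by (cases xs; cases "fst st 6 0 > 0") (auto intro!: wp_Seq wp_NAssign wp_RAssign wp_Cond simp: upd_simps all_bool_eq)

text \<open>The part of the store that the traversal reads but never writes.\<close>

definition setting where
  "setting N i x kr st \<longleftrightarrow> fst st 0 0 = N \<and> fst st 0 1 = i \<and> fst st 16 0 = N + 2
    \<and> fst st 5 0 = 2 * N + 4
    \<and> (\<forall>j\<in>{1..N+1}. fst st 1 (j - 1) = of_bool (x j))
    \<and> (\<forall>t a b. snd st 0 (4 * t + 2 * of_bool a + of_bool b - 6) = kr t a b)
    \<and> (\<forall>j\<le>N. snd st 8 j = fact j)"

text \<open>The sentinel N + 1 has weights too, so the last cell used is
  \<open>sp + 2 * N + 3\<close>, and blocks have length \<open>2 * N + 4\<close>.\<close>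

definition block :: "nat \<Rightarrow> (nat \<Rightarrow> real) \<Rightarrow> nat \<Rightarrow> (nat \<Rightarrow> bool \<Rightarrow> real) \<Rightarrow> bool" where
  "block N W sp w \<longleftrightarrow> (\<forall>j\<in>{1..N+1}. \<forall>b. W (sp + 2 * j + of_bool b) = w j b)"

text \<open>The entries of the table after all extensions of paths that end before \<open>s\<close>.\<close>

definition partial_sum where
  "partial_sum kr x w i s t k =
    (if t = 0 then of_bool (k = 0) else \<Sum>s'<min s t. path_step kr x w i s' t k)"

lemma partial_sum_complete:
  assumes "x 0" "i > 0" "t \<le> s"
  shows "partial_sum kr x w i s t k = path_sum kr x w i t k"
  using assms by (cases "t = 0") (simp_all add: partial_sum_def path_sum_0 path_sum_rec)

lemma partial_sum_Suc:
  "s < t \<Longrightarrow> partial_sum kr x w i (Suc s) t k = partial_sum kr x w i s t k + path_step kr x w i s t k"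
  by (simp add: partial_sum_def min_def Suc_le_eq)

text \<open>A row has N + 2 cells, one more than is specified: it catches what the shift by one
  pushes beyond column N. The zeros behind the table are the room for the next leaf.\<close>

definition table where
  "table N D db g \<longleftrightarrow> (\<forall>t\<le>N+1. \<forall>k\<le>N. D (db + t * (N + 2) + k) = g t k)
    \<and> (\<forall>q\<ge>db + (N + 2) * (N + 2). D q = (0::real))"

lemma rows_disjoint:
  fixes t t' :: nat
  assumes "t \<noteq> t'" "k < M" "k' < M"
  shows "t * M + k \<noteq> t' * M + k'"
proof
  assume "t * M + k = t' * M + k'"
  then have "(t * M + k) div M = (t' * M + k') div M" by simp
  then show False using assms by simp
qed

lemma table_add_row:
  fixes D :: "nat \<Rightarrow> real"
  assumes tab: "table N D db g" and "s < t" "t \<le> N + 1" "d \<le> 1"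
    and D': "D' = (\<lambda>q. if v \<le> q \<and> q \<le> v + N then D q + D (u + (q - v)) * r else D q)"
    and u: "u = db + s * (N + 2)" and v: "v = db + t * (N + 2) + d"
  shows "table N D' db (\<lambda>t' k. if t' = t then g t k + (if d \<le> k then g s (k - d) * r else 0) else g t' k)"
  unfolding table_def
proof (intro conjI allI impI)
  fix t' k assume t': "t' \<le> N + 1" and k: "k \<le> N"
  show "D' (db + t' * (N + 2) + k)
    = (if t' = t then g t k + (if d \<le> k then g s (k - d) * r else 0) else g t' k)"
  proof (cases "t' = t")
    case True
    have "D (db + s * (N + 2) + (k - d)) = g s (k - d)"
      using tab k assms(2,3) unfolding table_def by auto
    moreover have "D (db + t * (N + 2) + k) = g t k"
      using tab k assms(3) unfolding table_def by auto
    ultimately show ?thesis using True k by (auto simp: D' u v)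
  next
    case False
    \<comment> \<open>As \<open>d + N < N + 2\<close>, the updated cells all lie in row t, so a
      common cell would belong to two rows.\<close>
    have "\<not> (v \<le> db + t' * (N + 2) + k \<and> db + t' * (N + 2) + k \<le> v + N)"
    proof
      assume *: "v \<le> db + t' * (N + 2) + k \<and> db + t' * (N + 2) + k \<le> v + N"
      define k' where "k' = t' * (N + 2) + k - t * (N + 2)"
      have "k' < N + 2" "t' * (N + 2) + k = t * (N + 2) + k'"
        using * assms(4) unfolding k'_def v by auto
      with rows_disjoint[OF False, of k "N + 2" k'] k show False by simp
    qed
    then show ?thesis using False tab t' k unfolding D' table_def by auto
  qed
next
  fix q assume q: "db + (N + 2) * (N + 2) \<le> q"
  have "t * (N + 2) \<le> (N + 1) * (N + 2)" using assms(3) by (intro mult_right_mono) auto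
  then have "v + N < q" using q assms(4) unfolding v by simp
  then show "D' q = 0" using tab q unfolding D' table_def by auto
qed

lemma table_cong:
  "(\<And>t k. t \<le> N + 1 \<Longrightarrow> k \<le> N \<Longrightarrow> g t k = g' t k) \<Longrightarrow> table N D db g \<longleftrightarrow> table N D db g'"
  by (auto simp: table_def)

lemma extend_paths_correct:
  assumes "setting N i x kr st" "block N (snd st 1) (fst st 4 0) w"
    and x: "x 0" and "i > 0" and "N + 1 \<le> n"
    and s: "fst st 6 0 = s" "s \<le> N"
    and "fst st 12 0 = db" "fst st 10 0 = db + s * (N + 2)"
    and tab: "table N (snd st 2) db (partial_sum kr x w i s)"
  shows "wp n extend_paths (\<lambda>st'. table N (snd st' 2) db (partial_sum kr x w i (Suc s))) st"
proof -
  \<comment> \<open>At the loop head the \<open>seg\<close> vectors stand at t - 1, and exactly the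
    rows below t have been offered the step from s.\<close>
  define I where "I m st' \<longleftrightarrow> (\<exists>t. m + t = N + 2 \<and> s < t \<and> fst st' 7 0 = t
      \<and> setting N i x kr st' \<and> block N (snd st' 1) (fst st' 4 0) w
      \<and> fst st' 6 0 = s \<and> fst st' 10 0 = db + s * (N + 2) \<and> fst st' 11 0 = db + t * (N + 2)
      \<and> (\<forall>b. snd st' 4 (of_bool b) = seg kr x w s (t - Suc s) b)
      \<and> (\<forall>b. snd st' 5 (of_bool b) = seg kr x (\<lambda>_ _. 1) s (t - Suc s) b)
      \<and> table N (snd st' 2) db (\<lambda>t'. partial_sum kr x w i (if t' < t then Suc s else s) t'))"
    for m and st' :: store
  have step: "\<exists>m'. m = Suc m' \<and> wp n (advance 4 ;; weigh ;; advance 5 ;; step_factor ;; add_row ;;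
      ninc 7 (NConst 1) ;; ninc 11 (nvar 16)) (I m') st1"
    if I: "I m st1" and b: "bval (NLess (nvar 7) (NAdd (nvar 0) (NConst 2))) st1" for m st1
  proof -
    obtain t where t: "m + t = N + 2" "s < t" "fst st1 7 0 = t"
      and set1: "setting N i x kr st1" and blk1: "block N (snd st1 1) (fst st1 4 0) w"
      and st1: "fst st1 6 0 = s" "fst st1 10 0 = db + s * (N + 2)" "fst st1 11 0 = db + t * (N + 2)"
      and seg1: "\<And>b. snd st1 4 (of_bool b) = seg kr x w s (t - Suc s) b"
      "\<And>b. snd st1 5 (of_bool b) = seg kr x (\<lambda>_ _. 1) s (t - Suc s) b"
      and tab1: "table N (snd st1 2) db (\<lambda>t'. partial_sum kr x w i (if t' < t then Suc s else s) t')"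
      using I unfolding I_def by blast
    have tN: "t \<le> N + 1" using b set1 t by (simp add: setting_def)
    obtain m' where m': "m = Suc m'" using t tN by (cases m) auto
    have ts: "Suc (s + (t - Suc s)) = t" "Suc (t - Suc s) = t - s" using t by auto
    have segt: "seg kr x w' s (t - s) b = (seg kr x w' s (t - Suc s) False * kr t False b
        + seg kr x w' s (t - Suc s) True * kr t True b) * w' t b" for w' b
      using seg.simps(2)[of kr x w' s "t - Suc s" b] unfolding ts .
    have D1: "wp n (advance 4) (\<lambda>st'. \<forall>b. snd st' 4 (of_bool b) =
        seg kr x w s (t - Suc s) False * kr t False b + seg kr x w s (t - Suc s) True * kr t True b) st1"
      by (rule advance_correct) (use set1 t seg1 in \<open>auto simp: setting_def\<close>)
    show ?thesis
      unfolding m'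
    proof (rule exI[of _ m'], rule conjI[OF refl], rule wp_Seq, rule wp_mono[OF D1])
      fix st2
      assume v2: "\<forall>b. snd st2 4 (of_bool b) =
        seg kr x w s (t - Suc s) False * kr t False b + seg kr x w s (t - Suc s) True * kr t True b"
        and f2: "\<And>a. a \<notin> nmods (advance 4) \<Longrightarrow> fst st2 a = fst st1 a"
        "\<And>a. a \<notin> rmods (advance 4) \<Longrightarrow> snd st2 a = snd st1 a"
      note f2 = f2[unfolded advance_def mods_simps, simplified]
      have "wp n weigh (\<lambda>st'. \<forall>b. snd st' 4 (of_bool b) = (seg kr x w s (t - Suc s) False * kr t False b
        + seg kr x w s (t - Suc s) True * kr t True b) * w t b) st2"
        by (rule weigh_correct) (use f2 v2 t tN blk1 in \<open>auto simp: block_def\<close>)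
      then show "wp n (weigh ;; advance 5 ;; step_factor ;; add_row ;;
        ninc 7 (NConst 1) ;; ninc 11 (nvar 16)) (I m') st2"
      proof (rule wp_Seq[OF wp_mono])
        fix st3
        assume v3: "\<forall>b. snd st3 4 (of_bool b) = (seg kr x w s (t - Suc s) False * kr t False b
          + seg kr x w s (t - Suc s) True * kr t True b) * w t b"
          and f3: "\<And>a. a \<notin> nmods weigh \<Longrightarrow> fst st3 a = fst st2 a"
          "\<And>a. a \<notin> rmods weigh \<Longrightarrow> snd st3 a = snd st2 a"
        note f3 = f3[unfolded weigh_def mods_simps, simplified]
        have "wp n (advance 5) (\<lambda>st'. \<forall>b. snd st' 5 (of_bool b) =
          seg kr x (\<lambda>_ _. 1) s (t - Suc s) False * kr t False b
          + seg kr x (\<lambda>_ _. 1) s (t - Suc s) True * kr t True b) st3"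
          by (rule advance_correct) (use f2 f3 set1 t seg1 in \<open>auto simp: setting_def\<close>)
        then show "wp n (advance 5 ;; step_factor ;; add_row ;;
          ninc 7 (NConst 1) ;; ninc 11 (nvar 16)) (I m') st3"
        proof (rule wp_Seq[OF wp_mono])
          fix st4
          assume v4: "\<forall>b. snd st4 5 (of_bool b) = seg kr x (\<lambda>_ _. 1) s (t - Suc s) False * kr t False b
            + seg kr x (\<lambda>_ _. 1) s (t - Suc s) True * kr t True b"
            and f4: "\<And>a. a \<notin> nmods (advance 5) \<Longrightarrow> fst st4 a = fst st3 a"
            "\<And>a. a \<notin> rmods (advance 5) \<Longrightarrow> snd st4 a = snd st3 a"
          note f4 = f4[unfolded advance_def mods_simps, simplified]
          have fst4: "fst st4 = fst st1" using f2 f3 f4 by auto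
          have seg4: "snd st4 4 (of_bool b) = seg kr x w s (t - s) b"
            "snd st4 5 (of_bool b) = seg kr x (\<lambda>_ _. 1) s (t - s) b" for b
            using v3 v4 f4 by (simp_all add: segt)
          have "wp n step_factor (\<lambda>st'. snd st' 6 0 = (if fst st4 6 0 < fst st4 0 1 \<and> fst st4 0 1 < fst st4 7 0
              then -1 else 1) * (seg kr x w s (t - s) (x t) / seg kr x (\<lambda>_ _. 1) s (t - s) (x t))
              \<and> fst st' 15 0 = of_bool (fst st4 7 0 \<noteq> fst st4 0 1)) st4"
            by (rule step_factor_correct[where xt = "x t"])
              (use seg4 set1 t tN fst4 in \<open>auto simp: setting_def\<close>)
          then show "wp n (step_factor ;; add_row ;; ninc 7 (NConst 1) ;; ninc 11 (nvar 16)) (I m') st4"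
          proof (rule wp_Seq[OF wp_mono])
            fix st5
            assume v5: "snd st5 6 0 = (if fst st4 6 0 < fst st4 0 1 \<and> fst st4 0 1 < fst st4 7 0
              then -1 else 1) * (seg kr x w s (t - s) (x t) / seg kr x (\<lambda>_ _. 1) s (t - s) (x t))
              \<and> fst st5 15 0 = of_bool (fst st4 7 0 \<noteq> fst st4 0 1)"
              and f5: "\<And>a. a \<notin> nmods step_factor \<Longrightarrow> fst st5 a = fst st4 a"
              "\<And>a. a \<notin> rmods step_factor \<Longrightarrow> snd st5 a = snd st4 a"
            note f5 = f5[unfolded step_factor_def mods_simps, simplified]
            define r where "r = (if s < i \<and> i < t then -1 else 1) * seg_ratio kr x w s t"
            have i1: "fst st1 0 1 = i" "fst st1 0 0 = N" using set1 by (auto simp: setting_def)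
            have r5: "snd st5 6 0 = r" "fst st5 15 0 = of_bool (t \<noteq> i)"
              using v5 i1 t st1 unfolding fst4 r_def seg_ratio_def by auto
            have lt: "s * (N + 2) + (N + 2) \<le> t * (N + 2)"
              using mult_right_mono[of "Suc s" t "N + 2"] t by simp
            have "wp n add_row (\<lambda>st'. snd st' 2 = (\<lambda>q.
              if fst st5 11 0 + fst st5 15 0 \<le> q \<and> q \<le> fst st5 11 0 + fst st5 15 0 + N
              then snd st5 2 q + snd st5 2 (fst st5 10 0 + (q - (fst st5 11 0 + fst st5 15 0))) * snd st5 6 0
              else snd st5 2 q)) st5"
              by (rule add_row_correct) (use f5 fst4 i1 st1 lt \<open>N + 1 \<le> n\<close> in auto)
            then show "wp n (add_row ;; ninc 7 (NConst 1) ;; ninc 11 (nvar 16)) (I m') st5"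
            proof (rule wp_Seq[OF wp_mono])
              fix st6
              assume v6: "snd st6 2 = (\<lambda>q.
                if fst st5 11 0 + fst st5 15 0 \<le> q \<and> q \<le> fst st5 11 0 + fst st5 15 0 + N
                then snd st5 2 q + snd st5 2 (fst st5 10 0 + (q - (fst st5 11 0 + fst st5 15 0))) * snd st5 6 0
                else snd st5 2 q)"
                and f6: "\<And>a. a \<notin> nmods add_row \<Longrightarrow> fst st6 a = fst st5 a"
                "\<And>a. a \<notin> rmods add_row \<Longrightarrow> snd st6 a = snd st5 a"
              note f6 = f6[unfolded add_row_def mods_simps, simplified]
              have D5: "snd st5 2 = snd st1 2" using f2 f3 f4 f5 by simp
              have D6: "table N (snd st6 2) db (\<lambda>t' k. if t' = t
                then partial_sum kr x w i (if t < t then Suc s else s) t k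
                  + (if of_bool (t \<noteq> i) \<le> k
                     then partial_sum kr x w i (if s < t then Suc s else s) s (k - of_bool (t \<noteq> i)) * r else 0)
                else partial_sum kr x w i (if t' < t then Suc s else s) t' k)"
                by (rule table_add_row[OF tab1 t(2) tN _ v6[unfolded D5 r5(1)]])
                  (use f5 fst4 st1 r5 in auto)
              have "table N (snd st6 2) db (\<lambda>t'. partial_sum kr x w i (if t' < Suc t then Suc s else s) t')"
              proof (rule iffD1[OF table_cong D6])
                fix t' k assume "t' \<le> N + 1" "k \<le> N"
                \<comment> \<open>Row s is already final, since paths reach s only from smaller
                  elements.\<close>
                have "partial_sum kr x w i (Suc s) s k' = path_sum kr x w i s k'" for k'
                  by (rule partial_sum_complete) (use x \<open>i > 0\<close> in auto)
                then have "partial_sum kr x w i (Suc s) t k = partial_sum kr x w i s t k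
                  + (if of_bool (t \<noteq> i) \<le> k
                     then partial_sum kr x w i (Suc s) s (k - of_bool (t \<noteq> i)) * r else 0)"
                  unfolding partial_sum_Suc[OF t(2)] path_step_def r_def by auto
                then show "(if t' = t
                  then partial_sum kr x w i (if t < t then Suc s else s) t k
                    + (if of_bool (t \<noteq> i) \<le> k
                       then partial_sum kr x w i (if s < t then Suc s else s) s (k - of_bool (t \<noteq> i)) * r else 0)
                  else partial_sum kr x w i (if t' < t then Suc s else s) t' k)
                  = partial_sum kr x w i (if t' < Suc t then Suc s else s) t' k"
                  using t(2) by auto
              qed
              then show "wp n (ninc 7 (NConst 1) ;; ninc 11 (nvar 16)) (I m') st6"
                apply (intro wp_Seq wp_NAssign)
                unfolding I_def
                apply (intro exI[of _ "Suc t"])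
                using t m' set1 blk1 st1 seg4 f2 f3 f4 f5 f6
                by (simp add: upd_simps setting_def)
            qed
          qed
        qed
      qed
    qed
  qed
  have exit: "table N (snd st' 2) db (partial_sum kr x w i (Suc s))"
    if I: "I m st'" and "\<not> bval (NLess (nvar 7) (NAdd (nvar 0) (NConst 2))) st'" for m st'
  proof -
    obtain t where "m + t = N + 2" "fst st' 7 0 = t" "setting N i x kr st'"
      and tab': "table N (snd st' 2) db (\<lambda>t'. partial_sum kr x w i (if t' < t then Suc s else s) t')"
      using I unfolding I_def by blast
    with that(2) have "t = N + 2" by (simp add: setting_def)
    then show ?thesis by (intro iffD1[OF table_cong tab']) auto
  qed
  \<comment> \<open>Rows up to s receive nothing from s, so they may already be counted as
    done.\<close>
  have tab0: "table N (snd st 2) db (\<lambda>t. partial_sum kr x w i (if t < Suc s then Suc s else s) t)"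
    by (rule iffD1[OF table_cong tab]) (auto simp: partial_sum_def min_def less_Suc_eq)
  have "wp n start_paths (\<lambda>st'. \<forall>b. snd st' 4 (of_bool b) = of_bool (b = x s)
      \<and> snd st' 5 (of_bool b) = of_bool (b = x s)) st"
    by (rule start_paths_correct) (use assms in \<open>auto simp: setting_def\<close>)
  then show ?thesis
    unfolding extend_paths_def
  proof (rule wp_Seq[OF wp_mono])
    fix st1
    assume v1: "\<forall>b. snd st1 4 (of_bool b) = of_bool (b = x s) \<and> snd st1 5 (of_bool b) = of_bool (b = x s)"
      and f1: "\<And>a. a \<notin> nmods start_paths \<Longrightarrow> fst st1 a = fst st a"
      "\<And>a. a \<notin> rmods start_paths \<Longrightarrow> snd st1 a = snd st a"
    note f1 = f1[unfolded start_paths_def mods_simps, simplified]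
    define st2 where "st2 = nupd (nupd st1 7 0 (Suc s)) 11 0 (db + Suc s * (N + 2))"
    have "I (N + 1 - s) st2"
      unfolding I_def
      by (intro exI[of _ "Suc s"])
        (use assms v1 f1 tab0 in \<open>simp add: st2_def upd_simps setting_def\<close>)
    moreover have "nupd (nupd st1 7 0 (fst st1 6 0 + 1)) 11 0 (fst st1 10 0 + fst st1 16 0) = st2"
      using assms f1 by (simp add: st2_def setting_def algebra_simps)
    moreover have "N + 1 - s \<le> n" using assms by simp
    ultimately show "wp n (nset 7 (NAdd (nvar 6) (NConst 1)) ;; nset 11 (NAdd (nvar 10) (nvar 16)) ;;
      While (NLess (nvar 7) (NAdd (nvar 0) (NConst 2)))
       (advance 4 ;; weigh ;; advance 5 ;; step_factor ;; add_row ;; ninc 7 (NConst 1) ;; ninc 11 (nvar 16)))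
      (\<lambda>st'. table N (snd st' 2) db (partial_sum kr x w i (Suc s))) st1"
      by (intro wp_Seq wp_NAssign wp_While[where I = I and m = "N + 1 - s", OF _ _ step exit])
        (simp_all add: upd_simps)
  qed
qed

lemma add_result_correct:
  assumes "fst st 0 0 = N" "N \<ge> 1" "N \<le> n" "\<And>j. j \<le> N \<Longrightarrow> snd st 8 j = fact j"
  shows "wp n add_result (\<lambda>st'. snd st' 3 0 = snd st 3 0
    + (\<Sum>k<N - 1. shap_coeff N k * snd st 2 (fst st 10 0 + Suc k))) st"
proof -
  define I where "I m st' \<longleftrightarrow> (\<exists>k. m + k = N - 1 \<and> fst st' 8 0 = k \<and> fst st' 0 0 = N
    \<and> fst st' 10 0 = fst st 10 0 \<and> snd st' 2 = snd st 2 \<and> (\<forall>j\<le>N. snd st' 8 j = fact j)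
    \<and> snd st' 3 0 = snd st 3 0 + (\<Sum>k<k. shap_coeff N k * snd st 2 (fst st 10 0 + Suc k)))"
    for m and st' :: store
  show ?thesis
    unfolding add_result_def
    apply (rule wp_Seq, rule wp_NAssign, rule wp_While[where I = I and m = "N - 1"])
    subgoal using assms by (auto simp: I_def upd_simps)
    subgoal using assms by simp
    subgoal for m st'
      by (cases m) (use assms(2) in \<open>auto simp: I_def upd_simps shap_coeff_def
          intro!: wp_Seq wp_NAssign wp_RAssign\<close>)
    subgoal for m st'
    proof -
      assume I: "I m st'" and b: "\<not> bval (NLess (NAdd (nvar 8) (NConst 1)) (nvar 0)) st'"
      then obtain k where k: "m + k = N - 1" "fst st' 8 0 = k" "fst st' 0 0 = N"
        "snd st' 3 0 = snd st 3 0 + (\<Sum>k<k. shap_coeff N k * snd st 2 (fst st 10 0 + Suc k))"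
        unfolding I_def by blast
      then have "k = N - 1" using b by auto
      with k show ?thesis by simp
    qed
    done
qed

lemma do_leaf_correct:
  assumes "setting N i x kr st" "block N (snd st 1) (fst st 4 0) w"
    and "markov_kernel N p K kr" "x 0" "\<not> x (Suc N)" "w (Suc N) False = 1" "i \<in> {1..N}"
    and "N + 1 \<le> n" and zero: "\<And>q. q \<ge> fst st 12 0 \<Longrightarrow> snd st 2 q = 0"
  shows "wp n do_leaf (\<lambda>st'. snd st' 3 0 = snd st 3 0 + shap_sum N p K x i (weight_prod N w)
    \<and> (\<forall>q\<ge>fst st' 12 0. snd st' 2 q = 0)) st"
proof -
  have N: "N \<ge> 1" and i: "i > 0" using assms(7) by auto
  define db where "db = fst st 12 0"
  define I where "I m st' \<longleftrightarrow> (\<exists>s. m + s = N + 1 \<and> fst st' 6 0 = s \<and> fst st' 12 0 = db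
    \<and> fst st' 10 0 = db + s * (N + 2) \<and> setting N i x kr st' \<and> block N (snd st' 1) (fst st' 4 0) w
    \<and> snd st' 3 0 = snd st 3 0 \<and> table N (snd st' 2) db (partial_sum kr x w i s))"
    for m and st' :: store
  have step: "\<exists>m'. m = Suc m' \<and> wp n (extend_paths ;; ninc 6 (NConst 1) ;; ninc 10 (nvar 16)) (I m') st1"
    if I: "I m st1" and b: "bval (NLess (nvar 6) (NAdd (nvar 0) (NConst 1))) st1" for m st1
  proof -
    obtain s where s: "m + s = N + 1" "fst st1 6 0 = s" "fst st1 12 0 = db"
      "fst st1 10 0 = db + s * (N + 2)" "setting N i x kr st1" "block N (snd st1 1) (fst st1 4 0) w"
      "snd st1 3 0 = snd st 3 0" "table N (snd st1 2) db (partial_sum kr x w i s)"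
      using I unfolding I_def by blast
    have sN: "s \<le> N" using b s by (simp add: setting_def)
    then obtain m' where m': "m = Suc m'" using s by (cases m) auto
    have "wp n extend_paths (\<lambda>st'. table N (snd st' 2) db (partial_sum kr x w i (Suc s))) st1"
      by (rule extend_paths_correct[where s = s and st = st1]) (use assms s sN i in auto)
    then show ?thesis
      unfolding m'
    proof (intro exI[of _ m'] conjI refl, elim wp_Seq[OF wp_mono])
      fix st2
      assume t2: "table N (snd st2 2) db (partial_sum kr x w i (Suc s))"
        and f2: "\<And>a. a \<notin> nmods extend_paths \<Longrightarrow> fst st2 a = fst st1 a"
        "\<And>a. a \<notin> rmods extend_paths \<Longrightarrow> snd st2 a = snd st1 a"
      note f2 = f2[unfolded extend_paths_def start_paths_def advance_def weigh_def step_factor_def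
          add_row_def mods_simps, simplified]
      show "wp n (ninc 6 (NConst 1) ;; ninc 10 (nvar 16)) (I m') st2"
        apply (intro wp_Seq wp_NAssign)
        unfolding I_def
        apply (intro exI[of _ "Suc s"])
        using s m' t2 f2 by (simp add: upd_simps setting_def)
    qed
  qed
  define st1 where "st1 = nupd (nupd (rupd st 2 db 1) 6 0 0) 10 0 db"
  have I0: "I (N + 1) st1"
  proof -
    have "table N (snd st1 2) db (partial_sum kr x w i 0)"
      using zero by (auto simp: table_def st1_def upd_simps partial_sum_def db_def)
    then show ?thesis
      unfolding I_def using assms(1,2) by (simp add: st1_def upd_simps setting_def db_def)
  qed
  have fin: "wp n (add_result ;; nset 12 (NAdd (nvar 10) (nvar 16)))
      (\<lambda>st'. snd st' 3 0 = snd st 3 0 + shap_sum N p K x i (weight_prod N w)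
        \<and> (\<forall>q\<ge>fst st' 12 0. snd st' 2 q = 0)) st2"
    if I: "I m st2" and b: "\<not> bval (NLess (nvar 6) (NAdd (nvar 0) (NConst 1))) st2" for m st2
  proof -
    obtain s where s: "m + s = N + 1" "fst st2 6 0 = s" "setting N i x kr st2"
      "fst st2 10 0 = db + s * (N + 2)"
      "snd st2 3 0 = snd st 3 0" "table N (snd st2 2) db (partial_sum kr x w i s)"
      using I unfolding I_def by blast
    then have sN: "s = Suc N" using b by (simp add: setting_def)
    have D: "snd st2 2 (fst st2 10 0 + k) = path_sum kr x w i (Suc N) k" if "k \<le> N" for k
      using s(4,6) that partial_sum_complete[where x = x and i = i and s = "Suc N" and t = "Suc N" and kr = kr and w = w and k = k] assms(4) i
      unfolding sN table_def by auto
    have "wp n add_result (\<lambda>st'. snd st' 3 0 = snd st2 3 0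
        + (\<Sum>k<N - 1. shap_coeff N k * snd st2 2 (fst st2 10 0 + Suc k))) st2"
      by (rule add_result_correct) (use s N assms(8) in \<open>auto simp: setting_def\<close>)
    then show ?thesis
    proof (elim wp_Seq[OF wp_mono])
      fix st3
      assume v3: "snd st3 3 0 = snd st2 3 0
          + (\<Sum>k<N - 1. shap_coeff N k * snd st2 2 (fst st2 10 0 + Suc k))"
        and f3: "\<And>a. a \<notin> nmods add_result \<Longrightarrow> fst st3 a = fst st2 a"
        "\<And>a. a \<notin> rmods add_result \<Longrightarrow> snd st3 a = snd st2 a"
      note f3 = f3[unfolded add_result_def mods_simps, simplified]
      have "(\<Sum>k<N - 1. shap_coeff N k * snd st2 2 (fst st2 10 0 + Suc k))
        = (\<Sum>k<N - 1. shap_coeff N k * path_sum kr x w i (Suc N) (Suc k))"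
      proof (rule sum.cong[OF refl])
        fix k assume "k \<in> {..<N - 1}"
        then have "Suc k \<le> N" by auto
        from D[OF this] show "shap_coeff N k * snd st2 2 (fst st2 10 0 + Suc k)
          = shap_coeff N k * path_sum kr x w i (Suc N) (Suc k)" by simp
      qed
      also have "\<dots> = shap_sum N p K x i (weight_prod N w)"
        using shap_sum_eq_path_sum[where kr = kr and x = x and w = w] assms N by metis
      finally have "snd st3 3 0 = snd st 3 0 + shap_sum N p K x i (weight_prod N w)"
        using v3 s by simp
      moreover have "snd st2 2 q = 0" if "fst st2 10 0 + fst st2 16 0 \<le> q" for q
        using s that sN by (auto simp: table_def setting_def)
      ultimately show "wp n (nset 12 (NAdd (nvar 10) (nvar 16)))
        (\<lambda>st'. snd st' 3 0 = snd st 3 0 + shap_sum N p K x i (weight_prod N w)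
          \<and> (\<forall>q\<ge>fst st' 12 0. snd st' 2 q = 0)) st3"
        using f3 by (intro wp_NAssign) (auto simp: upd_simps)
    qed
  qed
  show ?thesis
    unfolding do_leaf_def
    by (intro wp_Seq wp_RAssign wp_NAssign, rule wp_While[where I = I and m = "N + 1"])
      (use I0 assms(8) step fin in \<open>simp_all add: st1_def db_def upd_simps\<close>)
qed

section \<open>The stack of weight blocks and the traversal\<close>

lemma block_cong:
  "(\<And>q. q < sp + (2 * N + 4) \<Longrightarrow> W q = W' q) \<Longrightarrow> block N W sp w = block N W' sp w"
  by (auto simp: block_def)

text \<open>Memory holds only the weights. The trees in the list are bookkeeping, tied to the unread
  code by \<open>pending\<close>.\<close>

primrec stack where
  "stack N W sp [] \<longleftrightarrow> sp = 0"
| "stack N W sp (y # ys) \<longleftrightarrow> 2 * N + 4 \<le> sp \<and> snd y (Suc N) False = 1 \<and> block N W sp (snd y)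
    \<and> stack N W (sp - (2 * N + 4)) ys"

lemma stack_cong:
  "(\<And>q. q < sp + (2 * N + 4) \<Longrightarrow> W q = W' q) \<Longrightarrow> stack N W sp ys = stack N W' sp ys"
proof (induction ys arbitrary: sp)
  case (Cons y ys)
  show ?case
  proof (cases "2 * N + 4 \<le> sp")
    case True
    have "stack N W (sp - (2 * N + 4)) ys = stack N W' (sp - (2 * N + 4)) ys"
      by (rule Cons.IH) (use Cons.prems True in auto)
    moreover have "block N W sp (snd y) = block N W' sp (snd y)"
      by (rule block_cong) (use Cons.prems in auto)
    ultimately show ?thesis by simp
  qed simp
qed simp

lemma stack_nonempty: "stack N W sp ys \<Longrightarrow> 0 < sp \<longleftrightarrow> ys \<noteq> []"
  by (cases ys) auto

lemma do_node_correct: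
  assumes "setting N i x kr st" "2 * N + 4 \<le> n"
    and v: "fst st 2 (fst st 3 0) = v" "v \<in> {1..N}"
    and "stack N (snd st 1) (fst st 4 0) ((T, w) # ys)"
  shows "wp n do_node (\<lambda>st'. stack N (snd st' 1) (fst st' 4 0)
      ((T0, forbid w v True) # (T1, forbid w v False) # ys)
    \<and> fst st' 3 0 = fst st 3 0 + 1) st"
proof -
  define sp L W where "sp = fst st 4 0" and "L = 2 * N + 4" and "W = snd st 1"
  define I where "I m st' \<longleftrightarrow> (\<exists>j. m + j = L \<and> fst st' 9 0 = j \<and> fst st' 4 0 = sp \<and> fst st' 5 0 = L
    \<and> fst st' 2 = fst st 2 \<and> fst st' 3 = fst st 3
    \<and> snd st' 1 = (\<lambda>q. if sp + L \<le> q \<and> q < sp + L + j then W (q - L) else W q))"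
    for m and st' :: store
  have L: "fst st 5 0 = L" using assms(1) by (simp add: setting_def L_def)
  have stk: "L \<le> sp" "w (Suc N) False = 1" "block N W sp w" "stack N W (sp - L) ys"
    using assms(5) by (simp_all add: sp_def L_def W_def)
  have exit: "wp n (RAssign 1 (NAdd (nvar 4) (NAdd (NCell 2 (nvar 3)) (NCell 2 (nvar 3)))) RZero ;;
      RAssign 1 (NAdd (NAdd (NAdd (nvar 4) (nvar 5)) (NAdd (NCell 2 (nvar 3)) (NCell 2 (nvar 3)))) (NConst 1)) RZero ;;
      ninc 4 (nvar 5) ;; ninc 3 (NConst 1))
      (\<lambda>st'. stack N (snd st' 1) (fst st' 4 0) ((T0, forbid w v True) # (T1, forbid w v False) # ys)
        \<and> fst st' 3 0 = fst st 3 0 + 1) st1"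
    if I: "I m st1" and b: "\<not> bval (NLess (nvar 9) (nvar 5)) st1" for m st1
  proof -
    have st1: "fst st1 4 0 = sp" "fst st1 5 0 = L" "fst st1 2 = fst st 2" "fst st1 3 = fst st 3"
      "snd st1 1 = (\<lambda>q. if sp + L \<le> q \<and> q < sp + L + L then W (q - L) else W q)"
      using I b by (auto simp: I_def)
    define W1 where "W1 = ((\<lambda>q. if sp + L \<le> q \<and> q < sp + L + L then W (q - L) else W q)
      (sp + (v + v) := 0))(sp + L + (v + v) + 1 := 0)"
    \<comment> \<open>By parity, an index 2a + c with c in {0,1} determines a and c.\<close>
    have odd: "a + a + of_bool c = v + v + of_bool d \<longleftrightarrow> a = v \<and> c = d" for a c d
      by (cases c; cases d) (auto, presburger+)
    have "block N W1 (sp + L) (forbid w v True)"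
      unfolding block_def
    proof (intro ballI allI)
      fix j b assume j: "j \<in> {1..N + 1}"
      have "W (sp + 2 * j + of_bool b) = w j b" using stk j by (auto simp: block_def)
      moreover have "sp + L + 2 * j + of_bool b = sp + L + (v + v) + 1 \<longleftrightarrow> j = v \<and> b"
        using odd[of j b True] by auto
      moreover have "sp + L + 2 * j + of_bool b \<noteq> sp + (v + v)" using v(2) by (auto simp: L_def)
      ultimately show "W1 (sp + L + 2 * j + of_bool b) = forbid w v True j b"
        using j v(2) by (auto simp: W1_def L_def algebra_simps)
    qed
    moreover have "block N W1 sp (forbid w v False)"
      unfolding block_def
    proof (intro ballI allI)
      fix j b assume j: "j \<in> {1..N + 1}"
      have "W (sp + 2 * j + of_bool b) = w j b" using stk j by (auto simp: block_def)
      moreover have "sp + 2 * j + of_bool b = sp + (v + v) \<longleftrightarrow> j = v \<and> \<not> b"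
        using odd[of j b False] by auto
      moreover have "sp + 2 * j + of_bool b \<noteq> sp + L + (v + v) + 1" using j by (auto simp: L_def)
      moreover have "sp + 2 * j + of_bool b < sp + L" using j by (auto simp: L_def)
      ultimately show "W1 (sp + 2 * j + of_bool b) = forbid w v False j b"
        using j v(2) by (auto simp: W1_def)
    qed
    moreover have "stack N W1 (sp - L) ys"
      using stk(4) by (rule iffD1[OF stack_cong, rotated])
        (use stk(1) v in \<open>auto simp: W1_def L_def\<close>)
    ultimately have "stack N W1 (sp + L) ((T0, forbid w v True) # (T1, forbid w v False) # ys)"
      using stk v(2) by (auto simp: L_def)
    then show ?thesis
      by (intro wp_Seq wp_RAssign wp_NAssign) (use st1 v in \<open>auto simp: upd_simps W1_def\<close>)
  qed
  show ?thesis
    unfolding do_node_def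
    apply (rule wp_Seq, rule wp_NAssign, rule wp_Seq, rule wp_While[where I = I and m = L])
    subgoal by (auto simp: I_def upd_simps sp_def W_def L)
    subgoal using assms by (simp add: L_def)
    subgoal for m st'
      by (cases m) (use stk(1) in \<open>auto simp: I_def upd_simps fun_eq_iff
          intro!: wp_Seq wp_NAssign wp_RAssign\<close>)
    subgoal by (rule exit)
    done
qed

definition score_sum where
  "score_sum N p K x i ys = (\<Sum>(T, w)\<leftarrow>ys. tree_score N p K x i T w)"

text \<open>In prefix notation the unread code is the concatenation of the stacked trees, topmost
  first. Each turn consumes one node, so the number \<open>m\<close> of nodes left counts the
  turns.\<close>

definition pending :: "nat \<Rightarrow> bool pmf \<Rightarrow> (nat \<Rightarrow> bool \<Rightarrow> bool pmf) \<Rightarrow> nat \<Rightarrow> (nat \<Rightarrow> bool)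
    \<Rightarrow> (nat \<Rightarrow> bool \<Rightarrow> bool \<Rightarrow> real) \<Rightarrow> real \<Rightarrow> nat \<Rightarrow> store \<Rightarrow> bool" where
  "pending N p K i x kr goal_score m st \<longleftrightarrow> (\<exists>ys. m = (\<Sum>(T, w)\<leftarrow>ys. dt_size T)
    \<and> (\<forall>y\<in>set ys. dt_vars (fst y) \<subseteq> {1..N})
    \<and> (\<forall>q<length (concat (map (dt_code \<circ> fst) ys)).
          fst st 2 (fst st 3 0 + q) = concat (map (dt_code \<circ> fst) ys) ! q)
    \<and> setting N i x kr st \<and> stack N (snd st 1) (fst st 4 0) ys
    \<and> snd st 3 0 + score_sum N p K x i ys = goal_score
    \<and> (\<forall>q\<ge>fst st 12 0. snd st 2 q = 0))"

lemma traverse_correct: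
  assumes "markov_kernel N p K kr" "x 0" "\<not> x (Suc N)" "i \<in> {1..N}"
    and n: "2 * N + 4 \<le> n" and m: "m \<le> n"
    and st: "pending N p K i x kr goal_score m st"
  shows "wp n traverse (\<lambda>st'. snd st' 3 0 = goal_score) st"
  unfolding traverse_def
proof (rule wp_While[where I = "pending N p K i x kr goal_score" and m = m, OF st m])
  fix m st
  assume I: "pending N p K i x kr goal_score m st" and b: "\<not> bval (NLess (NConst 0) (nvar 4)) st"
  obtain ys where "stack N (snd st 1) (fst st 4 0) ys" "snd st 3 0 + score_sum N p K x i ys = goal_score"
    using I unfolding pending_def by blast
  moreover from this have "ys = []" using b stack_nonempty by fastforce
  ultimately show "snd st 3 0 = goal_score" by (simp add: score_sum_def)
next
  fix m st
  assume I: "pending N p K i x kr goal_score m st" and b: "bval (NLess (NConst 0) (nvar 4)) st"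
  obtain ys where ys: "m = (\<Sum>(T, w)\<leftarrow>ys. dt_size T)" "\<And>y. y \<in> set ys \<Longrightarrow> dt_vars (fst y) \<subseteq> {1..N}"
    "\<And>q. q < length (concat (map (dt_code \<circ> fst) ys)) \<Longrightarrow>
      fst st 2 (fst st 3 0 + q) = concat (map (dt_code \<circ> fst) ys) ! q"
    "setting N i x kr st" "stack N (snd st 1) (fst st 4 0) ys"
    "snd st 3 0 + score_sum N p K x i ys = goal_score" "\<And>q. q \<ge> fst st 12 0 \<Longrightarrow> snd st 2 q = 0"
    using I unfolding pending_def by blast
  have "ys \<noteq> []" using b stack_nonempty[OF ys(5)] by simp
  then obtain T w zs where zs: "ys = (T, w) # zs" by (cases ys) auto
  let ?rest = "concat (map (dt_code \<circ> fst) zs)"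
  let ?leaf = "Cond (NLess (NConst 0) (NCell 2 (NAdd (nvar 3) (NConst 1)))) do_leaf SKIP ;;
    nset 4 (NSub (nvar 4) (nvar 5)) ;; ninc 3 (NConst 2)"
  let ?body = "Cond (NLess (NConst 0) (NCell 2 (nvar 3))) do_node ?leaf"
  show "\<exists>m'. m = Suc m' \<and> wp n ?body (pending N p K i x kr goal_score m') st"
  proof (cases T)
    case (Leaf b)
    define m' where "m' = (\<Sum>(T, w)\<leftarrow>zs. dt_size T)"
    have code: "fst st 2 (fst st 3 0) = 0" "fst st 2 (fst st 3 0 + 1) = of_bool b"
      using ys(3)[of 0] ys(3)[of 1] by (simp_all add: zs Leaf)
    have rest: "fst st 2 (fst st 3 0 + 2 + q) = ?rest ! q" if "q < length ?rest" for q
      using ys(3)[of "q + 2"] that by (simp add: zs Leaf add_ac)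
    have stk: "block N (snd st 1) (fst st 4 0) w" "w (Suc N) False = 1"
      "stack N (snd st 1) (fst st 4 0 - (2 * N + 4)) zs"
      using ys(5) by (simp_all add: zs)
    have "wp n (Cond (NLess (NConst 0) (NCell 2 (NAdd (nvar 3) (NConst 1)))) do_leaf SKIP)
      (\<lambda>st'. snd st' 3 0 = snd st 3 0 + tree_score N p K x i T w
        \<and> (\<forall>q\<ge>fst st' 12 0. snd st' 2 q = 0)) st"
    proof (rule wp_Cond)
      assume "bval (NLess (NConst 0) (NCell 2 (NAdd (nvar 3) (NConst 1)))) st"
      then have b using code by (cases b) auto
      have "wp n do_leaf (\<lambda>st'. snd st' 3 0 = snd st 3 0 + shap_sum N p K x i (weight_prod N w)
        \<and> (\<forall>q\<ge>fst st' 12 0. snd st' 2 q = 0)) st"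
        by (rule do_leaf_correct[OF ys(4) stk(1) assms(1-3) stk(2) assms(4)]) (use n ys(7) in auto)
      then show "wp n do_leaf (\<lambda>st'. snd st' 3 0 = snd st 3 0 + tree_score N p K x i T w
        \<and> (\<forall>q\<ge>fst st' 12 0. snd st' 2 q = 0)) st"
        unfolding Leaf tree_score_Leaf using \<open>b\<close> by simp
    next
      assume "\<not> bval (NLess (NConst 0) (NCell 2 (NAdd (nvar 3) (NConst 1)))) st"
      then have "\<not> b" using code by (cases b) auto
      then show "wp n SKIP (\<lambda>st'. snd st' 3 0 = snd st 3 0 + tree_score N p K x i T w
        \<and> (\<forall>q\<ge>fst st' 12 0. snd st' 2 q = 0)) st"
        using ys(7) by (auto simp: Leaf tree_score_Leaf intro!: wp_SKIP)
    qed
    then have "wp n ?leaf (pending N p K i x kr goal_score m') st"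
    proof (elim wp_Seq[OF wp_mono])
      fix st1
      assume v1: "snd st1 3 0 = snd st 3 0 + tree_score N p K x i T w
        \<and> (\<forall>q\<ge>fst st1 12 0. snd st1 2 q = 0)"
        and f1: "\<And>a. a \<notin> nmods (Cond (NLess (NConst 0) (NCell 2 (NAdd (nvar 3) (NConst 1)))) do_leaf SKIP)
          \<Longrightarrow> fst st1 a = fst st a"
        "\<And>a. a \<notin> rmods (Cond (NLess (NConst 0) (NCell 2 (NAdd (nvar 3) (NConst 1)))) do_leaf SKIP)
          \<Longrightarrow> snd st1 a = snd st a"
      note f1 = f1[unfolded do_leaf_def add_result_def extend_paths_def start_paths_def advance_def
          weigh_def step_factor_def add_row_def mods_simps, simplified]
      have "fst st 5 0 = 2 * N + 4" using ys(4) by (simp add: setting_def)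
      then show "wp n (nset 4 (NSub (nvar 4) (nvar 5)) ;; ninc 3 (NConst 2))
        (pending N p K i x kr goal_score m') st1"
        apply (intro wp_Seq wp_NAssign)
        unfolding pending_def
        apply (intro exI[of _ zs])
        using ys(2,4,6) rest stk(3) v1 f1
        by (auto simp: upd_simps setting_def m'_def zs score_sum_def)
    qed
    moreover have "m = Suc m'" by (simp add: ys(1) zs Leaf m'_def)
    ultimately show ?thesis
      by (intro exI[of _ m'] conjI wp_Cond) (use code in auto)
  next
    case (Node v T0 T1)
    define m' where "m' = dt_size T0 + dt_size T1 + (\<Sum>(T, w)\<leftarrow>zs. dt_size T)"
    define us where "us = (T0, forbid w v True) # (T1, forbid w v False) # zs"
    have v: "v \<in> {1..N}" using ys(2)[of "(T, w)"] by (simp add: zs Node)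
    have code: "fst st 2 (fst st 3 0) = v"
      using ys(3)[of 0] by (simp add: zs Node)
    have rest: "fst st 2 (fst st 3 0 + 1 + q) = concat (map (dt_code \<circ> fst) us) ! q"
      if "q < length (concat (map (dt_code \<circ> fst) us))" for q
      using ys(3)[of "q + 1"] that by (simp add: zs Node us_def)
    have "wp n do_node (\<lambda>st'. stack N (snd st' 1) (fst st' 4 0) us \<and> fst st' 3 0 = fst st 3 0 + 1) st"
      unfolding us_def
      by (rule do_node_correct[OF ys(4) n code v]) (use ys(5) in \<open>simp add: zs\<close>)
    then have "wp n do_node (pending N p K i x kr goal_score m') st"
    proof (rule wp_mono)
      fix st1
      assume v1: "stack N (snd st1 1) (fst st1 4 0) us \<and> fst st1 3 0 = fst st 3 0 + 1"
        and f1: "\<And>a. a \<notin> nmods do_node \<Longrightarrow> fst st1 a = fst st a"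
        "\<And>a. a \<notin> rmods do_node \<Longrightarrow> snd st1 a = snd st a"
      note f1 = f1[unfolded do_node_def mods_simps, simplified]
      have "snd st 3 0 + score_sum N p K x i us = goal_score"
        using ys(6) v by (simp add: zs us_def score_sum_def Node tree_score_Node)
      moreover have "dt_vars (fst y) \<subseteq> {1..N}" if "y \<in> set us" for y
        using that ys(2)[of "(T, w)"] ys(2)[of y] by (auto simp: us_def zs Node)
      moreover have "m' = (\<Sum>(T, w)\<leftarrow>us. dt_size T)" by (simp add: m'_def us_def)
      moreover have "setting N i x kr st1" using ys(4) f1 by (simp add: setting_def)
      ultimately show "pending N p K i x kr goal_score m' st1"
        unfolding pending_def by (intro exI[of _ us]) (use rest v1 f1 ys(7) in auto)
    qed
    moreover have "m = Suc m'" by (simp add: ys(1) zs Node m'_def)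
    ultimately show ?thesis
      by (intro exI[of _ m'] conjI wp_Cond) (use code v in auto)
  qed
qed

section \<open>Initialisation and layout of the parameters\<close>

lemma init_params_correct:
  assumes "fst st 0 0 = N" "N \<ge> 1"
  shows "wp n init_params (\<lambda>st'. snd st' 0 = (snd st 0)(4 * N - 2 := 1, 4 * N := 1)
    \<and> fst st' 5 0 = 2 * N + 4 \<and> fst st' 16 0 = N + 2) st"
proof -
  have *: "N + N + (N + N) = 4 * N" by simp
  show ?thesis
    unfolding init_params_def
    by (intro wp_Seq wp_NAssign wp_RAssign)
      (simp add: upd_simps assms(1) del: One_nat_def, simp only: *)
qed

lemma init_fact_correct:
  assumes "fst st 0 0 = N" "N \<le> n" "snd st 9 0 = 0"
  shows "wp n init_fact (\<lambda>st'. \<forall>j\<le>N. snd st' 8 j = fact j) st"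
proof -
  define I where "I m st' \<longleftrightarrow> (\<exists>k. m + k = N \<and> fst st' 9 0 = k \<and> fst st' 0 0 = N
    \<and> snd st' 9 0 = real k \<and> (\<forall>j\<le>k. snd st' 8 j = fact j))" for m and st' :: store
  show ?thesis
    unfolding init_fact_def
    apply (rule wp_Seq, rule wp_RAssign, rule wp_Seq, rule wp_NAssign,
        rule wp_While[where I = I and m = N])
    subgoal using assms by (simp add: I_def upd_simps)
    subgoal by (rule assms)
    subgoal for m st'
      by (cases m) (auto simp: I_def upd_simps le_Suc_eq intro!: wp_Seq wp_NAssign wp_RAssign)
    subgoal by (auto simp: I_def)
    done
qed

lemma init_block_correct:
  assumes "fst st 5 0 = L" "L \<le> n"
  shows "wp n init_block (\<lambda>st'. (\<forall>j<L. snd st' 1 (L + j) = 1) \<and> fst st' 4 0 = L) st"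
proof -
  define I where "I m st' \<longleftrightarrow> (\<exists>k. m + k = L \<and> fst st' 9 0 = k \<and> fst st' 5 0 = L
    \<and> (\<forall>j<k. snd st' 1 (L + j) = 1))" for m and st' :: store
  show ?thesis
    unfolding init_block_def
    apply (rule wp_Seq, rule wp_NAssign, rule wp_Seq, rule wp_While[where I = I and m = L])
    subgoal using assms by (simp add: I_def upd_simps)
    subgoal by (rule assms)
    subgoal for m st'
      by (cases m) (auto simp: I_def upd_simps less_Suc_eq intro!: wp_Seq wp_NAssign wp_RAssign)
    subgoal by (auto simp: I_def upd_simps intro!: wp_NAssign)
    done
qed

lemma markov_code_Suc:
  "N \<ge> 1 \<Longrightarrow> markov_code (Suc N) p K = markov_code N p K @
    [pmf (K N False) False, pmf (K N False) True, pmf (K N True) False, pmf (K N True) True]"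
  by (simp add: markov_code_def)

lemma length_markov_code: "N \<ge> 1 \<Longrightarrow> length (markov_code N p K) = 4 * N - 2"
  by (induction N rule: nat_induct_at_least) (simp_all add: markov_code_Suc, simp add: markov_code_def)

lemma nth_markov_code:
  assumes "j \<in> {1..<N}"
  shows "markov_code N p K ! (4 * Suc j + 2 * of_bool a + of_bool b - 6) = pmf (K j a) b"
proof -
  have "N \<ge> 1" using assms by auto
  then show ?thesis using assms
  proof (induction N rule: nat_induct_at_least)
    case (Suc N)
    show ?case
    proof (cases "j = N")
      case True
      have idx: "4 * Suc N + 2 * of_bool a + of_bool b - 6
        = length (markov_code N p K) + (2 * of_bool a + of_bool b)"
        using Suc.hyps by (simp add: length_markov_code)
      show ?thesis
        unfolding True markov_code_Suc[OF Suc.hyps] idx nth_append_length_plus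
        by (cases a; cases b) simp_all
    next
      case False
      then have j: "j \<in> {1..<N}" using Suc by auto
      then have "4 * Suc j + 2 * of_bool a + of_bool b - 6 < length (markov_code N p K)"
        using Suc.hyps by (cases a; cases b) (auto simp: length_markov_code)
      then show ?thesis
        unfolding markov_code_Suc[OF Suc.hyps] nth_append using Suc.IH[OF j] by simp
    qed
  qed simp
qed

lemma nth_markov_code_init: "markov_code N p K ! of_bool b = pmf p b"
  by (cases b) (simp_all add: markov_code_def)

text \<open>The code of the distribution ends right before cell 4N - 2, so the cells of the forced
  step overwrite none of it.\<close>

lemma markov_kernel_load:
  assumes "N \<ge> 1"
    and mem: "\<And>q. mem q = ((load [markov_code N p K] 0)(4 * N - 2 := 1, 4 * N := 1)) q"
  shows "markov_kernel N p K (\<lambda>t a b. mem (4 * t + 2 * of_bool a + of_bool b - 6))"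
proof -
  have low: "mem q = markov_code N p K ! q" if "q < 4 * N - 2" for q
    using that assms by (simp add: mem load_def length_markov_code)
  have "mem (4 * 1 + 2 * of_bool True + of_bool b - 6) = pmf p b" for b
    using low[of "of_bool b"] assms(1) nth_markov_code_init[of N p K b] by (cases b) simp_all
  moreover have "mem (4 * Suc j + 2 * of_bool a + of_bool b - 6) = pmf (K j a) b"
    if "j \<in> {1..<N}" for j a b
  proof -
    have "4 * Suc j + 2 * of_bool a + of_bool b - 6 < 4 * N - 2"
      using that by (cases a; cases b) auto
    from low[OF this] show ?thesis using nth_markov_code[OF that] by simp
  qed
  moreover have "mem (4 * Suc N + 2 * of_bool a + of_bool False - 6) = 1" for a
    using assms(1) by (cases a) (simp_all add: mem)
  ultimately show ?thesis unfolding markov_kernel_def by (auto simp: fun_eq_iff)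
qed

text \<open>The bound on \<open>n\<close> covers the longest loops: \<open>2 * N + 4\<close> turns
  to fill or copy a block, and \<open>dt_size T\<close> turns of the traversal.\<close>

lemma shap_program_correct:
  assumes "(N, T, x, i, p, K) \<in> shap_instances" and n: "2 * (dt_size T + N) + 5 \<le> n"
  shows "wp n shap_program (\<lambda>st'. result st' = shap_markov (N, T, x, i, p, K)) (shap_code (N, T, x, i, p, K))"
proof -
  have N: "N \<ge> 1" and T: "dt_vars T \<subseteq> {1..N}" and x: "x \<in> cube N" and i: "i \<in> {1..N}"
    and pos: "positive_params N p K"
    using assms(1) by (auto simp: shap_instances_def DT_def)
  define st where "st = shap_code (N, T, x, i, p, K)"
  \<comment> \<open>Outside {1..N} the point x is \<open>undefined\<close>; the sentinels at 0 and N
    + 1 must be 1 and 0.\<close>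
  define xx where "xx j = (if j = 0 then True else j \<le> N \<and> x j)" for j
  define goal_score where "goal_score = shap_markov (N, T, x, i, p, K)"
  have goal_score: "goal_score = tree_score N p K xx i T (\<lambda>_ _. 1)"
  proof -
    have "goal_score = shap_sum N p K x i (dt_fun T)"
      unfolding goal_score_def using shap_eq_shap_sum[OF N pos x i] by simp
    also have "\<dots> = tree_score N p K xx i T (\<lambda>_ _. 1)"
      unfolding tree_score_def by (rule shap_sum_cong) (auto simp: weight_prod_def xx_def)
    finally show ?thesis .
  qed
  have fst_st: "fst st = load [[N, i], map (\<lambda>j. of_bool (x j)) [1..<N+1], dt_code T]"
    and snd_st: "snd st = load [markov_code N p K]" by (simp_all add: st_def)
  have st: "fst st 0 0 = N" "fst st 0 1 = i" "fst st 3 0 = 0" "fst st 12 0 = 0"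
    "snd st 9 0 = 0" "snd st 3 0 = 0" "\<And>q. snd st 2 q = 0"
    "snd st 0 = load [markov_code N p K] 0"
    unfolding fst_st snd_st by (simp_all add: load_def)
  have bits: "fst st 1 (j - 1) = of_bool (xx j)" if "j \<in> {1..N+1}" for j
    unfolding fst_st using that by (auto simp: load_def xx_def nth_upt simp del: upt_Suc)
  have code: "fst st 2 q = dt_code T ! q" if "q < length (dt_code T)" for q
    unfolding fst_st using that by (simp add: load_def)
  have "wp n shap_program (\<lambda>st'. result st' = goal_score) st"
    unfolding shap_program_def
  proof (rule wp_Seq[OF wp_mono[OF init_params_correct[OF st(1) N]]])
    fix st1
    assume v1: "snd st1 0 = (snd st 0)(4 * N - 2 := 1, 4 * N := 1)
      \<and> fst st1 5 0 = 2 * N + 4 \<and> fst st1 16 0 = N + 2"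
      and f1: "\<And>a. a \<notin> nmods init_params \<Longrightarrow> fst st1 a = fst st a"
      "\<And>a. a \<notin> rmods init_params \<Longrightarrow> snd st1 a = snd st a"
    note f1 = f1[unfolded init_params_def mods_simps, simplified]
    have "wp n init_fact (\<lambda>st'. \<forall>j\<le>N. snd st' 8 j = fact j) st1"
      by (rule init_fact_correct) (use st f1 n in auto)
    then show "wp n (init_fact ;; init_block ;; traverse ;; rset 0 (rvar 3)) (\<lambda>st'. result st' = goal_score) st1"
    proof (rule wp_Seq[OF wp_mono])
      fix st2
      assume v2: "\<forall>j\<le>N. snd st2 8 j = fact j"
        and f2: "\<And>a. a \<notin> nmods init_fact \<Longrightarrow> fst st2 a = fst st1 a"
        "\<And>a. a \<notin> rmods init_fact \<Longrightarrow> snd st2 a = snd st1 a"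
      note f2 = f2[unfolded init_fact_def mods_simps, simplified]
      have "wp n init_block (\<lambda>st'. (\<forall>j<2 * N + 4. snd st' 1 (2 * N + 4 + j) = 1) \<and> fst st' 4 0 = 2 * N + 4) st2"
        by (rule init_block_correct) (use f2 v1 n in \<open>auto simp: trans_le_add2\<close>)
      then show "wp n (init_block ;; traverse ;; rset 0 (rvar 3)) (\<lambda>st'. result st' = goal_score) st2"
      proof (rule wp_Seq[OF wp_mono])
        fix st3
        assume v3: "(\<forall>j<2 * N + 4. snd st3 1 (2 * N + 4 + j) = 1) \<and> fst st3 4 0 = 2 * N + 4"
          and f3: "\<And>a. a \<notin> nmods init_block \<Longrightarrow> fst st3 a = fst st2 a"
          "\<And>a. a \<notin> rmods init_block \<Longrightarrow> snd st3 a = snd st2 a"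
        note f3 = f3[unfolded init_block_def mods_simps, simplified]
        \<comment> \<open>The kernel is whatever memory holds. Its row for t = 1 and state 0 is
          junk, which \<open>markov_kernel\<close> leaves open.\<close>
        define kr where "kr t a b = snd st3 0 (4 * t + 2 * of_bool a + of_bool b - 6)" for t a b
        have "markov_kernel N p K kr"
          unfolding kr_def by (rule markov_kernel_load[OF N]) (use f2 f3 v1 st in simp)
        moreover have "setting N i xx kr st3"
          unfolding setting_def using f1 f2 f3 v1 v2 st bits by (simp add: kr_def)
        moreover have "block N (snd st3 1) (2 * N + 4) (\<lambda>_ _. 1)"
          unfolding block_def
        proof (intro ballI allI)
          fix j b assume "j \<in> {1..N + 1}"
          then have "2 * j + of_bool b < 2 * N + 4" by (cases b) auto
          from v3[THEN conjunct1, rule_format, OF this]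
          show "snd st3 1 (2 * N + 4 + 2 * j + of_bool b) = 1" by (simp only: add.assoc)
        qed
        then have "stack N (snd st3 1) (fst st3 4 0) [(T, \<lambda>_ _. 1)]"
          using v3 by simp
        ultimately have "wp n traverse (\<lambda>st'. snd st' 3 0 = goal_score) st3"
          by (intro traverse_correct[where m = "dt_size T" and kr = kr and x = xx])
            (use n i T f1 f2 f3 st code in
              \<open>auto simp: pending_def xx_def score_sum_def goal_score intro!: exI[of _ "[(T, \<lambda>_ _. 1)]"]\<close>)
        then show "wp n (traverse ;; rset 0 (rvar 3)) (\<lambda>st'. result st' = goal_score) st3"
          by (rule wp_Seq[OF wp_mono]) (auto intro!: wp_RAssign simp: result_def upd_simps)
      qed
    qed
  qed
  then show ?thesis by (simp only: st_def goal_score_def)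
qed

theorem corollary4p3:
  shows "in_FP shap_instances shap_size shap_code shap_markov"
  unfolding in_FP_def
proof (rule exI[of _ shap_program], rule exI[of _ "pcompose (time_poly shap_program) [:5, 2:]"], rule ballI)
  fix a :: shap_instance
  assume a: "a \<in> shap_instances"
  obtain N T x i p K where eq: "a = (N, T, x, i, p, K)" by (cases a)
  \<comment> \<open>The polynomial \<open>[:5, 2:]\<close> is the iteration bound, twice the size
    plus 5.\<close>
  have "wp (poly [:5, 2:] (shap_size a)) shap_program (\<lambda>st'. result st' = shap_markov a) (shap_code a)"
    using shap_program_correct[of N T x i p K "poly [:5, 2:] (shap_size a)"] a by (simp add: eq)
  then obtain t s' where *: "exec shap_program (shap_code a) t s'"
    "t \<le> poly (time_poly shap_program) (poly [:5, 2:] (shap_size a))" "result s' = shap_markov a"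
    unfolding wp_def by blast
  then have "t \<le> poly (pcompose (time_poly shap_program) [:5, 2:]) (shap_size a)"
    by (simp only: poly_pcompose)
  with * show "\<exists>t s'. exec shap_program (shap_code a) t s'
      \<and> t \<le> poly (pcompose (time_poly shap_program) [:5, 2:]) (shap_size a) \<and> result s' = shap_markov a"
    by blast
qed

end
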